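(* Let $m,n\ge1$ be integers, let $-\Delta_m\in\mathbb{R}^{m\times m}$ be symmetric positive definite, let $T>0$, $\gamma>0$, $\tau=T/n$, $\alpha=\tau^2/\sqrt\gamma$, and let $$\mathcal{T}=B_n^{(1)}\otimes I_m-\tfrac{\tau^2}{2}B_n^{(2)}\otimes\Delta_m,\qquad \mathcal{A}=\begin{bmatrix}\alpha\check I_n\otimes I_m & \mathcal{T}^T\\ \mathcal{T} & -\alpha\hat I_n\otimes I_m\end{bmatrix},$$ $$|\mathcal{H}|=\begin{bmatrix}\sqrt{\mathcal{T}^T\mathcal{T}+\alpha^2I_{mn}} & \\ & \sqrt{\mathcal{T}\mathcal{T}^T+\alpha^2I_{mn}}\end{bmatrix}.$$ Then (eigenvalues counted with multiplicity): (a) $\lambda=1$ is an eigenvalue of $|\mathcal{H}|^{-1}\mathcal{A}$ of multiplicity at least $nm-2m$, and $\lambda=-1$ is an eigenvalue of $|\mathcal{H}|^{-1}\mathcal{A}$ of multiplicity at least $nm-2m$; (b) at most $4m$ eigenvalues of $|\mathcal{H}|^{-1}\mathcal{A}$ are not equal to $\pm1$; (c) the spectrum of $|\mathcal{H}|^{-1}\mathcal{A}$ is contained in $(-\frac32,-\frac12)\cup(\frac12,\frac32)$, with at most $m$ eigenvalues in $(-\frac32,-1)$, at most $m$ in $(-1,-\frac12)$, at most $m$ in $(\frac12,1)$, and at most $m$ in $(1,\frac32)$.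
   Context: $B_n^{(1)}\in\mathbb{R}^{n\times n}$ is the lower triangular Toeplitz matrix with $1$ on the diagonal, $-2$ on the first subdiagonal, $1$ on the second subdiagonal and $0$ elsewhere. $B_n^{(2)}\in\mathbb{R}^{n\times n}$ is the lower triangular Toeplitz matrix with $1$ on the diagonal, $0$ on the first subdiagonal, $1$ on the second subdiagonal and $0$ elsewhere. $\hat I_n=\mathrm{diag}(\frac12,1,\dots,1)$ and $\check I_n=\mathrm{diag}(1,\dots,1,\frac12)$, both $n\times n$. $\sqrt{\cdot}$ is the symmetric positive semidefinite square root. (For $n\le 2$ a lower bound $nm-2m\le0$ on a multiplicity is vacuous.) *)

theory Defs
  imports
    "Jordan_Normal_Form.Spectral_Radius"
    "Jordan_Normal_Form.Gauss_Jordan_Elimination"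
begin

definition kron :: "real mat \<Rightarrow> real mat \<Rightarrow> real mat" (infixl "\<otimes>\<^sub>k" 70) where
  "A \<otimes>\<^sub>k B = mat (dim_row A * dim_row B) (dim_col A * dim_col B)
     (\<lambda>(i, j). A $$ (i div dim_row B, j div dim_col B) * B $$ (i mod dim_row B, j mod dim_col B))"

definition B1 :: "nat \<Rightarrow> real mat" where
  "B1 n = mat n n (\<lambda>(i, j). if i = j then 1 else if i = j + 1 then - 2 else if i = j + 2 then 1 else 0)"

definition B2 :: "nat \<Rightarrow> real mat" where
  "B2 n = mat n n (\<lambda>(i, j). if i = j then 1 else if i = j + 2 then 1 else 0)"

(* Indices start at 0; for n = 1 both matrices are the 1 x 1 matrix with entry 1/2. *)
definition I_hat :: "nat \<Rightarrow> real mat" where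
  "I_hat n = mat_diag n (\<lambda>i. if i = 0 then 1 / 2 else 1)"

definition I_check :: "nat \<Rightarrow> real mat" where
  "I_check n = mat_diag n (\<lambda>i. if i = n - 1 then 1 / 2 else 1)"

definition sym_pos_def :: "real mat \<Rightarrow> bool" where
  "sym_pos_def A \<longleftrightarrow> square_mat A \<and> A\<^sup>T = A \<and>
     (\<forall>v \<in> carrier_vec (dim_row A). v \<noteq> 0\<^sub>v (dim_row A) \<longrightarrow> 0 < v \<bullet> (A *\<^sub>v v))"

definition sym_pos_semidef :: "real mat \<Rightarrow> bool" where
  "sym_pos_semidef A \<longleftrightarrow> square_mat A \<and> A\<^sup>T = A \<and>
     (\<forall>v \<in> carrier_vec (dim_row A). 0 \<le> v \<bullet> (A *\<^sub>v v))"

definition mat_sqrt :: "real mat \<Rightarrow> real mat" where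
  "mat_sqrt A = (THE S. S \<in> carrier_mat (dim_row A) (dim_row A) \<and> sym_pos_semidef S \<and> S * S = A)"

(* The library function mat_inverse returns None on singular matrices;
   mat_inv is unspecified there. *)
definition mat_inv :: "real mat \<Rightarrow> real mat" where
  "mat_inv A = the (mat_inverse A)"

abbreviation complex_mat :: "real mat \<Rightarrow> complex mat" where
  "complex_mat \<equiv> map_mat complex_of_real"

(* All complex eigenvalues of a real matrix, counted with algebraic multiplicity. *)
definition eigvals_mset :: "real mat \<Rightarrow> complex multiset" where
  "eigvals_mset A = proots (char_poly (complex_mat A))"

definition num_eigvals_in :: "real mat \<Rightarrow> real set \<Rightarrow> nat" where
  "num_eigvals_in A X = size {# z \<in># eigvals_mset A. z \<in> complex_of_real ` X #}"

end

(*
Write A = H + E, where H is A with both diagonal corrections replaced by identities and E is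
diagonal with m entries -alpha/2, m entries alpha/2 and zeros elsewhere. Then H^2 = |H|^2 =: P^2,
so H x = mu P x gives |H x| = |P x| and mu = 1 or -1; testing the quadratic form of H on the two
coordinate subspaces shows that both signs occur mn times. Since T is injective, P > alpha, hence
|<x, E x>| < <x, P x> / 2. The eigenvalues of P^(-1) A are those of the pencil A x = lambda P x,
and Courant-Fischer dimension counts on subspaces cut out by linear equations (the m coordinates
where E has a given sign, and the P-orthogonal complement of an eigenspace of (H, P)) give (c) and
show that mn eigenvalues are positive and mn are negative. Parts (a) and (b) follow by counting.
*)
theory Submission
  imports Defs
begin

section \<open>The real spectral theorem\<close>

text \<open>The diagonal corrections are split off because scalar diagonal blocks
  \<open>\<alpha>\<close> and \<open>-\<alpha>\<close> make the off-diagonal blocks of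
  \<open>H * H\<close> cancel, so that the pencil of \<open>H\<close> and \<open>P\<close> has a
  known spectrum. Each correction halves a single diagonal block of size \<open>m\<close>; this is
  the source of the \<open>m\<close> in every count and of the size \<open>\<alpha> / 2\<close> of
  the perturbation. The endpoints 1/2 and 3/2 are 1 - 1/2 and 1 + 1/2. They are excluded because
  \<open>P\<close> exceeds \<open>\<alpha>\<close> strictly, which rests on forward substitution:
  the Toeplitz matrix is block lower triangular with positive definite diagonal blocks I -
  (\<tau>^2/2) \<Delta>. The product of the inverse of \<open>P\<close> with \<open>A\<close> is in
  general not symmetric. Its eigenvalues are made accessible by a congruence that turns
  \<open>P\<close> into the identity and \<open>A\<close> into a diagonal matrix. No eigenvalue of
  \<open>A\<close> is traced back to one of \<open>H\<close>; only cardinalities of index sets are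
  compared. Dimensions of subspaces enter through one fact alone: fewer than n homogeneous linear
  equations in n unknowns have a nonzero solution.\<close>

lemma symmetric_scalar_prod:
  fixes A :: "real mat"
  assumes "A \<in> carrier_mat n n" "A\<^sup>T = A" "x \<in> carrier_vec n" "y \<in> carrier_vec n"
  shows "x \<bullet> (A *\<^sub>v y) = (A *\<^sub>v x) \<bullet> y"
  using transpose_vec_mult_scalar[of A n n y x] assms by simp

lemma scalar_prod_self_pos:
  fixes v :: "real vec"
  assumes "v \<in> carrier_vec n" "v \<noteq> 0\<^sub>v n"
  shows "0 < v \<bullet> v"
  using conjugate_square_greater_0_vec[OF assms(1)] assms(2) by simp

lemma scalar_prod_self_nonneg: "0 \<le> (v :: real vec) \<bullet> v"
  unfolding scalar_prod_def by (simp add: sum_nonneg)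

text \<open>A complex eigenvector w = a + ib exists because the spectrum is nonempty. Comparing real
  and imaginary parts expresses \<open>A *\<^sub>v a\<close> and \<open>A *\<^sub>v b\<close>
  through \<open>a\<close> and \<open>b\<close>; symmetry of \<open>A\<close> then forces the
  eigenvalue to be real, and whichever of \<open>a\<close>, \<open>b\<close> is nonzero serves as
  eigenvector.\<close>

lemma symmetric_has_real_eigenvector:
  fixes A :: "real mat"
  assumes A: "A \<in> carrier_mat n n" and sym: "A\<^sup>T = A" and n: "n > 0"
  obtains c v where "v \<in> carrier_vec n" "v \<noteq> 0\<^sub>v n" "A *\<^sub>v v = c \<cdot>\<^sub>v v"
proof -
  have cA: "complex_mat A \<in> carrier_mat n n" using A by simp
  obtain z w where w: "w \<in> carrier_vec n" "w \<noteq> 0\<^sub>v n" and zw: "complex_mat A *\<^sub>v w = z \<cdot>\<^sub>v w"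
    using spectrum_non_empty[OF cA n] A
    by (auto simp: spectrum_def eigenvalue_def eigenvector_def)
  define a b where "a = map_vec Re w" and "b = map_vec Im w"
  have ab: "a \<in> carrier_vec n" "b \<in> carrier_vec n" using w by (auto simp: a_def b_def)
  have *: "(complex_mat A *\<^sub>v w) $ i = z * w $ i" if "i < n" for i
    using zw that w by simp
  have Aa: "A *\<^sub>v a = Re z \<cdot>\<^sub>v a - Im z \<cdot>\<^sub>v b"
  proof (rule eq_vecI)
    fix i assume "i < dim_vec (Re z \<cdot>\<^sub>v a - Im z \<cdot>\<^sub>v b)"
    hence i: "i < n" using ab by simp
    have "(A *\<^sub>v a) $ i = Re ((complex_mat A *\<^sub>v w) $ i)"
      using i A w by (simp add: a_def scalar_prod_def)
    also have "\<dots> = (Re z \<cdot>\<^sub>v a - Im z \<cdot>\<^sub>v b) $ i"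
      unfolding *[OF i] using i ab w by (simp add: a_def b_def)
    finally show "(A *\<^sub>v a) $ i = (Re z \<cdot>\<^sub>v a - Im z \<cdot>\<^sub>v b) $ i" .
  qed (use A ab in auto)
  have Ab: "A *\<^sub>v b = Re z \<cdot>\<^sub>v b + Im z \<cdot>\<^sub>v a"
  proof (rule eq_vecI)
    fix i assume "i < dim_vec (Re z \<cdot>\<^sub>v b + Im z \<cdot>\<^sub>v a)"
    hence i: "i < n" using ab by simp
    have "(A *\<^sub>v b) $ i = Im ((complex_mat A *\<^sub>v w) $ i)"
      using i A w by (simp add: b_def scalar_prod_def)
    also have "\<dots> = (Re z \<cdot>\<^sub>v b + Im z \<cdot>\<^sub>v a) $ i"
      unfolding *[OF i] using i ab w by (simp add: a_def b_def)
    finally show "(A *\<^sub>v b) $ i = (Re z \<cdot>\<^sub>v b + Im z \<cdot>\<^sub>v a) $ i" .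
  qed (use A ab in auto)
  have ne: "a \<noteq> 0\<^sub>v n \<or> b \<noteq> 0\<^sub>v n"
  proof (rule ccontr)
    assume c: "\<not> ?thesis"
    have "w = 0\<^sub>v n"
    proof (rule eq_vecI)
      fix i assume "i < dim_vec (0\<^sub>v n :: complex vec)"
      hence i: "i < n" by simp
      have "a $ i = 0" "b $ i = 0" using c i by auto
      thus "w $ i = 0\<^sub>v n $ i" using i w by (simp add: a_def b_def complex_eq_iff)
    qed (use w in auto)
    with w show False by simp
  qed
  \<comment> \<open>After substitution the terms with \<open>Re z\<close> cancel, and what is left
    is \<open>Im z\<close> times the squared norm of w.\<close>
  have "b \<bullet> (A *\<^sub>v a) = (A *\<^sub>v b) \<bullet> a"
    by (rule symmetric_scalar_prod[OF A sym ab(2,1)])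
  hence "Im z * (a \<bullet> a + b \<bullet> b) = 0"
    unfolding Aa Ab using ab
    by (simp add: scalar_prod_minus_distrib[of _ n] add_scalar_prod_distrib[of _ n] algebra_simps)
  moreover have "a \<bullet> a + b \<bullet> b > 0"
    using ne scalar_prod_self_pos[OF ab(1)] scalar_prod_self_pos[OF ab(2)]
      scalar_prod_self_nonneg[of a] scalar_prod_self_nonneg[of b] by fastforce
  ultimately have im: "Im z = 0" by simp
  have "A *\<^sub>v a = Re z \<cdot>\<^sub>v a" "A *\<^sub>v b = Re z \<cdot>\<^sub>v b"
    unfolding Aa Ab im using ab by auto
  with ne ab that show ?thesis by blast
qed

text \<open>The Householder reflection I - c w w^T in the hyperplane orthogonal to \<open>v\<close>
  - e_0 swaps the two unit vectors e_0 and \<open>v\<close>. It completes a unit eigenvector to an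
  orthonormal basis, and being a symmetric involution it is its own inverse and transpose.\<close>

lemma householder_reflection:
  fixes v :: "real vec"
  assumes v: "v \<in> carrier_vec n" and n: "n > 0" and unit: "v \<bullet> v = 1"
  obtains R where "R \<in> carrier_mat n n" "R\<^sup>T = R" "R * R = 1\<^sub>m n" "R *\<^sub>v unit_vec n 0 = v"
proof
  define w where "w = v - unit_vec n 0"
  have w: "w \<in> carrier_vec n" using v by (simp add: w_def)
  \<comment> \<open>If \<open>w = 0\<close> then \<open>c = 0\<close> and \<open>R\<close> below is the identity.\<close>
  define c where "c = 2 / (w \<bullet> w)"
  define R where "R = mat n n (\<lambda>(i, j). (if i = j then 1 else 0) - c * w $ i * w $ j)"
  show "R \<in> carrier_mat n n" by (simp add: R_def)
  show "R\<^sup>T = R" by (rule eq_matI) (auto simp: R_def)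
  have ww: "(\<Sum>k<n. w $ k * w $ k) = w \<bullet> w"
    using w by (simp add: scalar_prod_def lessThan_atLeast0)
  show "R * R = 1\<^sub>m n"
  proof (rule eq_matI)
    fix i j assume "i < dim_row (1\<^sub>m n :: real mat)" "j < dim_col (1\<^sub>m n :: real mat)"
    hence ij: "i < n" "j < n" by auto
    have "(R * R) $$ (i, j) = (\<Sum>k<n. ((if i = k then 1 else 0) - c * w $ i * w $ k) *
          ((if k = j then 1 else 0) - c * w $ k * w $ j))"
      using ij by (simp add: R_def scalar_prod_def lessThan_atLeast0)
    also have "\<dots> = (\<Sum>k<n. (if i = k then (if k = j then 1 else 0) - c * w $ k * w $ j else 0)
        - (if k = j then c * w $ i * w $ k else 0) + c^2 * w $ i * w $ j * (w $ k * w $ k))"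
      by (rule sum.cong) (auto simp: algebra_simps power2_eq_square)
    also have "\<dots> = (if i = j then 1 else 0) - 2 * c * w $ i * w $ j
        + c^2 * w $ i * w $ j * (w \<bullet> w)"
      using ij unfolding ww[symmetric] by (simp add: sum.distrib sum_subtractf sum_distrib_left)
    also have "c^2 * w $ i * w $ j * (w \<bullet> w) = 2 * c * w $ i * w $ j"
      by (simp add: c_def power2_eq_square field_simps)
    finally show "(R * R) $$ (i, j) = 1\<^sub>m n $$ (i, j)" using ij by simp
  qed (auto simp: R_def)
  have nv: "(\<Sum>k<n. v $ k * v $ k) = 1"
    using v unit by (simp add: scalar_prod_def lessThan_atLeast0)
  have "w \<bullet> w = (\<Sum>k<n. v $ k * v $ k - (if k = 0 then 2 * v $ k - 1 else 0))"
    unfolding ww[symmetric] using v n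
    by (intro sum.cong) (auto simp: w_def algebra_simps)
  also have "\<dots> = 2 - 2 * v $ 0" using n by (simp add: sum_subtractf nv)
  finally have wv: "w \<bullet> w = 2 - 2 * v $ 0" .
  show "R *\<^sub>v unit_vec n 0 = v"
  proof (cases "w = 0\<^sub>v n")
    case True
    have "R *\<^sub>v unit_vec n 0 = unit_vec n 0"
      using n by (intro eq_vecI) (auto simp: R_def True c_def)
    moreover have "v = unit_vec n 0"
    proof (rule eq_vecI)
      fix i assume "i < dim_vec (unit_vec n 0 :: real vec)"
      thus "v $ i = unit_vec n 0 $ i" using arg_cong[OF True, of "\<lambda>u. u $ i"] v by (auto simp: w_def)
    qed (use v in auto)
    ultimately show ?thesis by simp
  next
    case False
    have "w \<bullet> w > 0" by (rule scalar_prod_self_pos[OF w False])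
    \<comment> \<open>The entry \<open>w $ 0\<close> is \<open>v $ 0 - 1\<close>, minus half of
      \<open>w \<bullet> w\<close>. Hence the reflection sends e_0 to e_0 + w =
      \<open>v\<close>.\<close>
    hence c0: "c * w $ 0 = - 1" using wv v n by (simp add: c_def w_def field_simps)
    show ?thesis
    proof (rule eq_vecI)
      fix i assume "i < dim_vec v"
      hence i: "i < n" using v by simp
      have "(R *\<^sub>v unit_vec n 0) $ i = (if i = 0 then 1 else 0) - (c * w $ 0) * w $ i"
        using i n by (simp add: R_def)
      also have "\<dots> = v $ i" unfolding c0 using i v by (simp add: w_def)
      finally show "(R *\<^sub>v unit_vec n 0) $ i = v $ i" .
    qed (use v in \<open>auto simp: R_def\<close>)
  qed
qed

text \<open>Deflation: a reflection \<open>R\<close> carries e_0 to a unit eigenvector, so column 0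
  of \<open>R * A * R\<close> is a multiple of e_0, and by symmetry so is row 0. The induction
  hypothesis diagonalizes the remaining symmetric block by some \<open>U\<close>, and
  \<open>R * F\<close> with \<open>F\<close> = diag(1, \<open>U\<close>) diagonalizes
  \<open>A\<close>.\<close>

theorem real_spectral:
  fixes A :: "real mat"
  assumes "A \<in> carrier_mat n n" and "A\<^sup>T = A"
  shows "\<exists>U l. U \<in> carrier_mat n n \<and> U\<^sup>T * U = 1\<^sub>m n \<and> U\<^sup>T * A * U = mat_diag n l"
  using assms
proof (induction n arbitrary: A)
  case 0
  show ?case
    by (intro exI[of _ "1\<^sub>m 0"] exI[of _ "\<lambda>_. 0"] conjI eq_matI) (use 0 in \<open>auto simp: mat_diag_def\<close>)
next
  case (Suc n)
  note A = Suc.prems(1) and sym = Suc.prems(2)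
  obtain c u where u: "u \<in> carrier_vec (Suc n)" "u \<noteq> 0\<^sub>v (Suc n)" and Au: "A *\<^sub>v u = c \<cdot>\<^sub>v u"
    using symmetric_has_real_eigenvector[OF A sym] by blast
  define v where "v = (1 / sqrt (u \<bullet> u)) \<cdot>\<^sub>v u"
  have v: "v \<in> carrier_vec (Suc n)" using u by (simp add: v_def)
  have uu: "u \<bullet> u > 0" by (rule scalar_prod_self_pos[OF u])
  have "v \<bullet> v = 1" using u uu by (simp add: v_def)
  then obtain R where R: "R \<in> carrier_mat (Suc n) (Suc n)" "R\<^sup>T = R" "R * R = 1\<^sub>m (Suc n)"
    and Re: "R *\<^sub>v unit_vec (Suc n) 0 = v"
    using householder_reflection[OF v] by blast
  have Av: "A *\<^sub>v v = c \<cdot>\<^sub>v v"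
    using A u unfolding v_def
    by (subst mult_mat_vec[of _ "Suc n" "Suc n"]) (auto simp: Au smult_smult_assoc mult.commute)
  define B where "B = R * A * R"
  have B: "B \<in> carrier_mat (Suc n) (Suc n)" using R A by (simp add: B_def)
  have BT: "B\<^sup>T = B"
    unfolding B_def using R A sym by (simp add: transpose_mult[of _ "Suc n" "Suc n" _ "Suc n"] assoc_mult_mat[of _ "Suc n" "Suc n"])
  have Rv: "R *\<^sub>v v = unit_vec (Suc n) 0"
    unfolding Re[symmetric] using R
    by (simp add: assoc_mult_mat_vec[of R "Suc n" "Suc n" R "Suc n", symmetric])
  have "B *\<^sub>v unit_vec (Suc n) 0 = R *\<^sub>v (A *\<^sub>v (R *\<^sub>v unit_vec (Suc n) 0))"
    unfolding B_def using R A by (simp add: assoc_mult_mat_vec[of _ "Suc n" "Suc n" _ "Suc n"])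
  also have "\<dots> = c \<cdot>\<^sub>v unit_vec (Suc n) 0"
    unfolding Re Av using R v by (simp add: Rv mult_mat_vec[of _ "Suc n" "Suc n"])
  finally have Be: "B *\<^sub>v unit_vec (Suc n) 0 = c \<cdot>\<^sub>v unit_vec (Suc n) 0" .
  have B0: "B $$ (i, 0) = (if i = 0 then c else 0)" if "i < Suc n" for i
    using arg_cong[OF Be, of "\<lambda>w. w $ i"] that B by simp
  have B0': "B $$ (0, i) = (if i = 0 then c else 0)" if "i < Suc n" for i
    using B0[OF that] arg_cong[OF BT, of "\<lambda>M. M $$ (i, 0)"] that B by simp
  define A' where "A' = mat n n (\<lambda>(i, j). B $$ (Suc i, Suc j))"
  have A': "A' \<in> carrier_mat n n" by (simp add: A'_def)
  have BSym: "B $$ (i, j) = B $$ (j, i)" if "i < Suc n" "j < Suc n" for i j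
    using arg_cong[OF BT, of "\<lambda>M. M $$ (j, i)"] that B by simp
  have "A'\<^sup>T = A'" by (rule eq_matI) (auto simp: A'_def BSym)
  then obtain U l where U: "U \<in> carrier_mat n n" "U\<^sup>T * U = 1\<^sub>m n" "U\<^sup>T * A' * U = mat_diag n l"
    using Suc.IH[OF A'] by blast
  let ?l = "\<lambda>i. case i of 0 \<Rightarrow> c | Suc i \<Rightarrow> l i"
  define F where "F = four_block_mat (1\<^sub>m 1) (0\<^sub>m 1 n) (0\<^sub>m n 1) U"
  have F: "F \<in> carrier_mat (Suc n) (Suc n)" using U by (intro carrier_matI) (simp_all add: F_def)
  have FT: "F\<^sup>T = four_block_mat (1\<^sub>m 1) (0\<^sub>m 1 n) (0\<^sub>m n 1) (U\<^sup>T)"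
    unfolding F_def using U by (subst transpose_four_block_mat[of _ 1 1 _ n _ n]) auto
  have FF: "F\<^sup>T * F = 1\<^sub>m (Suc n)"
  proof -
    have "F\<^sup>T * F = four_block_mat (1\<^sub>m 1) (0\<^sub>m 1 n) (0\<^sub>m n 1) (U\<^sup>T * U)"
      unfolding FT unfolding F_def using U by (subst mult_four_block_mat[of _ 1 1 _ n _ n]) auto
    thus ?thesis using U(2) by simp
  qed
  have Bblock: "B = four_block_mat (c \<cdot>\<^sub>m 1\<^sub>m 1) (0\<^sub>m 1 n) (0\<^sub>m n 1) A'"
    using B B0 B0' by (intro eq_matI) (auto simp: A'_def)
  have "F\<^sup>T * B * F = four_block_mat (c \<cdot>\<^sub>m 1\<^sub>m 1) (0\<^sub>m 1 n) (0\<^sub>m n 1) (U\<^sup>T * A' * U)"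
    unfolding FT Bblock unfolding F_def using U A'
    by (simp add: mult_four_block_mat[of _ 1 1 _ n _ n _ _ 1 _ n])
  also have "\<dots> = mat_diag (Suc n) ?l"
    unfolding U(3) by (rule eq_matI) (auto simp: mat_diag_def split: nat.split)
  finally have FBF: "F\<^sup>T * B * F = mat_diag (Suc n) ?l" .
  show ?case
  proof (intro exI conjI)
    show "R * F \<in> carrier_mat (Suc n) (Suc n)" using R F by simp
    have T: "(R * F)\<^sup>T = F\<^sup>T * R"
      using R F by (simp add: transpose_mult[of _ "Suc n" "Suc n" _ "Suc n"])
    have "F\<^sup>T * R * (R * F) = F\<^sup>T * (R * R) * F"
      using R(1) F by (simp add: assoc_mult_mat[of _ "Suc n" "Suc n" _ "Suc n" _ "Suc n"])
    thus "(R * F)\<^sup>T * (R * F) = 1\<^sub>m (Suc n)" unfolding T using R F FF by simp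
    have "F\<^sup>T * R * A * (R * F) = F\<^sup>T * B * F"
      using R(1) F A by (simp add: B_def assoc_mult_mat[of _ "Suc n" "Suc n" _ "Suc n" _ "Suc n"])
    thus "(R * F)\<^sup>T * A * (R * F) = mat_diag (Suc n) ?l" unfolding T FBF .
  qed
qed

section \<open>Symmetric pencils\<close>

lemma mat_diag_form:
  fixes l :: "nat \<Rightarrow> real"
  assumes "x \<in> carrier_vec n" "y \<in> carrier_vec n"
  shows "x \<bullet> (mat_diag n l *\<^sub>v y) = (\<Sum>i<n. l i * (x $ i * y $ i))"
proof -
  have "(mat_diag n l *\<^sub>v y) $ i = l i * y $ i" if "i < n" for i
    using that assms by (simp add: mat_diag_def scalar_prod_def if_distrib[of "\<lambda>x. x * _"] sum.delta' cong: if_cong)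
  thus ?thesis using assms
    by (auto simp: scalar_prod_def[of x] lessThan_atLeast0 mat_diag_def intro!: sum.cong)
qed

lemma congruence_form:
  fixes B :: "real mat"
  assumes B: "B \<in> carrier_mat n n" and V: "V \<in> carrier_mat n n"
    and xy: "x \<in> carrier_vec n" "y \<in> carrier_vec n"
  shows "(V *\<^sub>v x) \<bullet> (B *\<^sub>v (V *\<^sub>v y)) = x \<bullet> ((V\<^sup>T * B * V) *\<^sub>v y)"
proof -
  have "x \<bullet> ((V\<^sup>T * B * V) *\<^sub>v y) = x \<bullet> (V\<^sup>T *\<^sub>v (B *\<^sub>v (V *\<^sub>v y)))"
    using B V xy by (simp add: assoc_mult_mat_vec[of _ n n _ n])
  also have "\<dots> = (V\<^sup>T *\<^sub>v (B *\<^sub>v (V *\<^sub>v y))) \<bullet> x"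
    using B V xy by (intro comm_scalar_prod[of _ n]) auto
  also have "\<dots> = (B *\<^sub>v (V *\<^sub>v y)) \<bullet> (V *\<^sub>v x)"
    using B V xy by (intro transpose_vec_mult_scalar[of _ n n]) auto
  also have "\<dots> = (V *\<^sub>v x) \<bullet> (B *\<^sub>v (V *\<^sub>v y))"
    using B V xy by (intro comm_scalar_prod[of _ n]) auto
  finally show ?thesis by simp
qed

text \<open>The vectors of \<open>S\<close> are the rows of a square matrix filled up with zero
  rows. At least the last row is zero, so the transpose annihilates the last unit vector, the
  determinant vanishes, and the matrix has a nonzero kernel vector.\<close>

lemma exists_nonzero_orthogonal:
  fixes S :: "real vec set"
  assumes S: "finite S" "S \<subseteq> carrier_vec n" "card S < n"
  obtains x where "x \<in> carrier_vec n" "x \<noteq> 0\<^sub>v n" "\<And>s. s \<in> S \<Longrightarrow> s \<bullet> x = 0"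
proof -
  obtain cs where cs: "set cs = S" "length cs = card S"
    using S(1) by (metis distinct_card finite_distinct_list)
  define C where "C = mat n n (\<lambda>(i, j). if i < length cs then (cs ! i) $ j else 0)"
  have C: "C \<in> carrier_mat n n" by (simp add: C_def)
  have "C\<^sup>T *\<^sub>v unit_vec n (n - 1) = 0\<^sub>v n"
    using S(3) cs(2) by (intro eq_vecI) (auto simp: C_def)
  moreover have "unit_vec n (n - 1) \<noteq> (0\<^sub>v n :: real vec)"
    using S(3) by (intro unit_vec_nonzero) simp
  ultimately have "det (C\<^sup>T) = 0"
    using C by (subst det_0_iff_vec_prod_zero[of _ n]) (auto intro!: exI[of _ "unit_vec n (n - 1)"])
  hence "det C = 0" using det_transpose[OF C] by simp
  then obtain x where x: "x \<in> carrier_vec n" "x \<noteq> 0\<^sub>v n" "C *\<^sub>v x = 0\<^sub>v n"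
    using C det_0_iff_vec_prod_zero[of C n] by blast
  show ?thesis
  proof (rule that[OF x(1,2)])
    fix s assume "s \<in> S"
    then obtain i where i: "i < length cs" "cs ! i = s"
      using cs(1) by (metis in_set_conv_nth)
    have "s \<in> carrier_vec n" using \<open>s \<in> S\<close> S(2) by auto
    hence "row C i = s" using i S(3) cs(2) by (intro eq_vecI) (auto simp: C_def)
    moreover have "(C *\<^sub>v x) $ i = 0" using x(3) i S(3) cs(2) by simp
    ultimately show "s \<bullet> x = 0" using C i S(3) cs(2) by simp
  qed
qed

lemma nonzero_entry:
  assumes "y \<in> carrier_vec n" "y \<noteq> 0\<^sub>v n"
  obtains j where "j < n" "y $ j \<noteq> 0"
  using assms by (metis carrier_vecD eq_vecI index_zero_vec)

text \<open>Simultaneous diagonalization by congruence of the pencil A x = \<lambda> P x: the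
  columns of \<open>V\<close> are \<open>P\<close>-orthonormal eigenvectors, and the equation with
  \<open>1\<^sub>m n\<close> encodes positive definiteness of \<open>P\<close>. The list
  \<open>l\<close> carries no order; multiplicities are cardinalities of sets of indices.\<close>

definition pair_diag :: "nat \<Rightarrow> real mat \<Rightarrow> real mat \<Rightarrow> real mat \<Rightarrow> (nat \<Rightarrow> real) \<Rightarrow> bool" where
  "pair_diag n P A V l \<longleftrightarrow> P \<in> carrier_mat n n \<and> P\<^sup>T = P \<and> A \<in> carrier_mat n n \<and>
     V \<in> carrier_mat n n \<and> V\<^sup>T * P * V = 1\<^sub>m n \<and> V\<^sup>T * A * V = mat_diag n l"

lemma pair_diagD:
  assumes "pair_diag n P A V l"
  shows "P \<in> carrier_mat n n" "P\<^sup>T = P" "A \<in> carrier_mat n n" "V \<in> carrier_mat n n"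
    "V\<^sup>T * P * V = 1\<^sub>m n" "V\<^sup>T * A * V = mat_diag n l"
  using assms by (auto simp: pair_diag_def)

lemma pair_diag_inverse:
  assumes "pair_diag n P A V l"
  shows "V * (V\<^sup>T * P) = 1\<^sub>m n"
  by (rule mat_mult_left_right_inverse[of "V\<^sup>T * P"])
     (use pair_diagD[OF assms] in \<open>auto\<close>)

lemma pair_diag_forms:
  assumes "pair_diag n P A V l" and y: "y \<in> carrier_vec n"
  shows "(V *\<^sub>v y) \<bullet> (A *\<^sub>v (V *\<^sub>v y)) = (\<Sum>i<n. l i * (y $ i)\<^sup>2)"
    and "(V *\<^sub>v y) \<bullet> (P *\<^sub>v (V *\<^sub>v y)) = (\<Sum>i<n. (y $ i)\<^sup>2)"
proof -
  note D = pair_diagD[OF assms(1)]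
  show "(V *\<^sub>v y) \<bullet> (A *\<^sub>v (V *\<^sub>v y)) = (\<Sum>i<n. l i * (y $ i)\<^sup>2)"
    unfolding congruence_form[OF D(3,4) y y] D(6) mat_diag_form[OF y y] by (simp add: power2_eq_square)
  show "(V *\<^sub>v y) \<bullet> (P *\<^sub>v (V *\<^sub>v y)) = (\<Sum>i<n. (y $ i)\<^sup>2)"
    unfolding congruence_form[OF D(1,4) y y] D(5) using y
    by (simp add: scalar_prod_def power2_eq_square lessThan_atLeast0)
qed

text \<open>Since \<open>V\<^sup>T * P\<close> is the inverse of \<open>V\<close>, coordinate i of
  \<open>x\<close> in the basis of columns is read off by the vector
  \<open>P *\<^sub>v col V i\<close>. The vanishing of a coordinate thereby becomes a linear
  equation on \<open>x\<close>, the form of constraint used in the dimension counts.\<close>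

lemma pair_diag_expand:
  assumes pd: "pair_diag n P A V l" and x: "x \<in> carrier_vec n"
  obtains y where "y \<in> carrier_vec n" "x = V *\<^sub>v y"
    "\<And>i. i < n \<Longrightarrow> y $ i = (P *\<^sub>v col V i) \<bullet> x"
proof
  note D = pair_diagD[OF pd]
  let ?y = "(V\<^sup>T * P) *\<^sub>v x"
  show y: "?y \<in> carrier_vec n" using D x by simp
  have "V *\<^sub>v ?y = (V * (V\<^sup>T * P)) *\<^sub>v x"
    using D x by (intro assoc_mult_mat_vec[symmetric, of _ n n _ n]) auto
  thus "x = V *\<^sub>v ?y" unfolding pair_diag_inverse[OF pd] using x by simp
  fix i assume i: "i < n"
  have "?y $ i = (V\<^sup>T *\<^sub>v (P *\<^sub>v x)) $ i"
    using D x by (simp add: assoc_mult_mat_vec[of _ n n _ n])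
  also have "\<dots> = col V i \<bullet> (P *\<^sub>v x)" using D i x by simp
  also have "\<dots> = (P *\<^sub>v col V i) \<bullet> x"
    using D i x by (intro symmetric_scalar_prod[of _ n]) auto
  finally show "?y $ i = (P *\<^sub>v col V i) \<bullet> x" .
qed

lemma pair_diag_vec_nonzero:
  assumes pd: "pair_diag n P A V l" and y: "y \<in> carrier_vec n" "y \<noteq> 0\<^sub>v n"
  shows "V *\<^sub>v y \<noteq> 0\<^sub>v n"
proof
  note D = pair_diagD[OF pd]
  assume "V *\<^sub>v y = 0\<^sub>v n"
  hence "(\<Sum>i<n. (y $ i)\<^sup>2) = 0"
    unfolding pair_diag_forms(2)[OF pd y(1), symmetric] using D by simp
  hence "y $ i = 0" if "i < n" for i using that by (simp add: sum_nonneg_eq_0_iff)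
  with y show False by (auto intro: eq_vecI)
qed

text \<open>The congruence only gives the quadratic forms on the columns. The eigenvector equation
  follows because \<open>V * V\<^sup>T\<close> is the inverse of \<open>P\<close>: putting
  \<open>P * (V * V\<^sup>T)\<close> in front of \<open>A * V\<close> yields
  \<open>A * V = P * V * mat_diag n l\<close>.\<close>

lemma pair_diag_col:
  assumes pd: "pair_diag n P A V l" and i: "i < n"
  shows "A *\<^sub>v col V i = l i \<cdot>\<^sub>v (P *\<^sub>v col V i)"
    and "col V i \<bullet> (P *\<^sub>v col V i) = 1"
    and "col V i \<bullet> (A *\<^sub>v col V i) = l i"
proof -
  note D = pair_diagD[OF pd]
  have col: "V *\<^sub>v unit_vec n i = col V i"
    using D i by (intro eq_vecI) auto
  have e: "unit_vec n i \<in> carrier_vec n" by simp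
  have delta: "(\<Sum>j<n. f j * (unit_vec n i $ j)\<^sup>2) = f i" for f :: "nat \<Rightarrow> real"
  proof -
    have "(\<Sum>j<n. f j * (unit_vec n i $ j)\<^sup>2) = (\<Sum>j<n. if j = i then f j else 0)"
      by (intro sum.cong) (use i in auto)
    thus ?thesis using i by simp
  qed
  show "col V i \<bullet> (P *\<^sub>v col V i) = 1" "col V i \<bullet> (A *\<^sub>v col V i) = l i"
    unfolding col[symmetric] pair_diag_forms[OF pd e] using delta[of "\<lambda>_. 1"] delta[of l]
    by simp_all
  have "(V * V\<^sup>T) * P = 1\<^sub>m n"
    using pair_diag_inverse[OF pd] D by simp
  hence PVV: "P * (V * V\<^sup>T) = 1\<^sub>m n"
    using D by (intro mat_mult_left_right_inverse[of "V * V\<^sup>T"]) auto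
  have "A * V = (P * (V * V\<^sup>T)) * (A * V)" unfolding PVV using D by simp
  also have "\<dots> = P * V * (V\<^sup>T * A * V)"
    using D by (simp add: assoc_mult_mat[of _ n n _ n _ n])
  finally have AV: "A * V = P * V * mat_diag n l" unfolding D(6) .
  have e: "mat_diag n l *\<^sub>v unit_vec n i = l i \<cdot>\<^sub>v unit_vec n i"
    using i by (intro eq_vecI) (auto simp: mat_diag_def)
  have "A *\<^sub>v col V i = (A * V) *\<^sub>v unit_vec n i"
    using D unfolding col[symmetric] by (simp add: assoc_mult_mat_vec[of _ n n _ n])
  also have "\<dots> = (P * V) *\<^sub>v (l i \<cdot>\<^sub>v unit_vec n i)"
    unfolding AV e[symmetric] using D by (simp add: assoc_mult_mat_vec[of _ n n _ n])
  also have "\<dots> = l i \<cdot>\<^sub>v (P *\<^sub>v col V i)"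
    using D unfolding col[symmetric] by (simp add: assoc_mult_mat_vec[of _ n n _ n] mult_mat_vec[of _ n n])
  finally show "A *\<^sub>v col V i = l i \<cdot>\<^sub>v (P *\<^sub>v col V i)" .
qed

lemma pair_diag_form_gt:
  assumes pd: "pair_diag n P A V l" and l: "\<And>i. i < n \<Longrightarrow> c < l i"
    and x: "x \<in> carrier_vec n" "x \<noteq> 0\<^sub>v n"
  shows "c * (x \<bullet> (P *\<^sub>v x)) < x \<bullet> (A *\<^sub>v x)"
proof -
  obtain y where y: "y \<in> carrier_vec n" "x = V *\<^sub>v y"
    using pair_diag_expand[OF pd x(1)] by blast
  have "y \<noteq> 0\<^sub>v n" using x y pair_diagD[OF pd] by auto
  then obtain j where j: "j < n" "y $ j \<noteq> 0" using nonzero_entry[OF y(1)] by blast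
  have "0 < (\<Sum>i<n. (l i - c) * (y $ i)\<^sup>2)"
    using j l by (intro sum_pos2[of _ j]) (auto simp: less_imp_le)
  thus ?thesis unfolding y(2) pair_diag_forms[OF pd y(1)]
    by (simp add: algebra_simps sum_subtractf sum_distrib_left)
qed

text \<open>Two spectral decompositions: with the eigenvectors \<open>U\<close> and eigenvalues
  \<open>d\<close> of \<open>P\<close>, the matrix \<open>W\<close> = U d^(-1/2) turns
  \<open>P\<close> into the identity. An orthogonal \<open>Q\<close> that diagonalizes
  \<open>W\<^sup>T * A * W\<close> does not disturb this, so \<open>V\<close> is
  \<open>W * Q\<close>.\<close>

lemma pair_diag_exists:
  assumes P: "P \<in> carrier_mat n n" "sym_pos_def P" and A: "A \<in> carrier_mat n n" "A\<^sup>T = A"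
  obtains V l where "pair_diag n P A V l"
proof -
  have PT: "P\<^sup>T = P" and pos: "\<And>v. v \<in> carrier_vec n \<Longrightarrow> v \<noteq> 0\<^sub>v n \<Longrightarrow> 0 < v \<bullet> (P *\<^sub>v v)"
    using P by (auto simp: sym_pos_def_def)
  obtain U d where U: "U \<in> carrier_mat n n" "U\<^sup>T * U = 1\<^sub>m n" "U\<^sup>T * P * U = mat_diag n d"
    using real_spectral[OF P(1) PT] by blast
  have pdU: "pair_diag n (1\<^sub>m n) P U d" using U P by (simp add: pair_diag_def)
  have d: "d i > 0" if "i < n" for i
  proof -
    have c: "col U i \<in> carrier_vec n" using U(1) by (auto intro: carrier_vecI)
    have "col U i \<noteq> 0\<^sub>v n" using pair_diag_col(2)[OF pdU that] c by auto
    from pos[OF c this] show ?thesis using pair_diag_col(3)[OF pdU that] by simp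
  qed
  define D where "D = mat_diag n (\<lambda>i. 1 / sqrt (d i))"
  have D: "D \<in> carrier_mat n n" "D\<^sup>T = D" by (auto simp: D_def mat_diag_def)
  define W where "W = U * D"
  have W: "W \<in> carrier_mat n n" using U D by (simp add: W_def)
  have WT: "W\<^sup>T = D * U\<^sup>T" using U D by (simp add: W_def transpose_mult[of _ n n _ n])
  have "W\<^sup>T * P * W = D * (U\<^sup>T * P * U) * D"
    unfolding WT using U(1) D(1) P(1) by (simp add: W_def assoc_mult_mat[of _ n n _ n _ n])
  also have "\<dots> = mat_diag n (\<lambda>i. 1 / sqrt (d i) * d i * (1 / sqrt (d i)))"
    unfolding U(3) by (simp add: D_def)
  also have "\<dots> = 1\<^sub>m n"
    using d by (intro eq_matI) (auto simp: mat_diag_def real_div_sqrt less_imp_le dest: less_imp_neq[OF d])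
  finally have WPW: "W\<^sup>T * P * W = 1\<^sub>m n" .
  have "(W\<^sup>T * A * W)\<^sup>T = W\<^sup>T * A * W"
    using W A by (simp add: transpose_mult[of _ n n _ n])
  then obtain Q l where Q: "Q \<in> carrier_mat n n" "Q\<^sup>T * Q = 1\<^sub>m n"
      "Q\<^sup>T * (W\<^sup>T * A * W) * Q = mat_diag n l"
    using real_spectral[of "W\<^sup>T * A * W" n] W A by auto
  have VT: "(W * Q)\<^sup>T = Q\<^sup>T * W\<^sup>T" using W Q by (simp add: transpose_mult[of _ n n _ n])
  have "(W * Q)\<^sup>T * P * (W * Q) = Q\<^sup>T * (W\<^sup>T * P * W) * Q"
    unfolding VT using W Q(1) P(1) by (simp add: assoc_mult_mat[of _ n n _ n _ n])
  moreover have "(W * Q)\<^sup>T * A * (W * Q) = Q\<^sup>T * (W\<^sup>T * A * W) * Q"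
    unfolding VT using W Q(1) A(1) by (simp add: assoc_mult_mat[of _ n n _ n _ n])
  ultimately have "pair_diag n P A (W * Q) l"
    unfolding pair_diag_def WPW Q(3) using P A PT W Q by simp
  thus ?thesis by (rule that)
qed

section \<open>Courant-Fischer counts under linear constraints\<close>

lemma pair_diag_restricted_vector:
  assumes pd: "pair_diag n P A V l" and I: "I \<subseteq> {..<n}"
    and S: "finite S" "S \<subseteq> carrier_vec n" "card S < card I"
  obtains x y where "x \<in> carrier_vec n" "x \<noteq> 0\<^sub>v n" "\<And>s. s \<in> S \<Longrightarrow> s \<bullet> x = 0"
    "\<And>c. x \<bullet> (A *\<^sub>v x) - c * (x \<bullet> (P *\<^sub>v x)) = (\<Sum>i\<in>I. (l i - c) * (y i)\<^sup>2)"
    "\<exists>i\<in>I. y i \<noteq> 0"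
proof -
  note D = pair_diagD[OF pd]
  have fI: "finite I" using I finite_subset by blast
  \<comment> \<open>The unknown is the coordinate vector \<open>y\<close>: \<open>n - card I\<close>
    equations make it vanish outside \<open>I\<close>, and \<open>card S\<close> further ones state
    that \<open>V *\<^sub>v y\<close> is orthogonal to \<open>S\<close>, each moved to
    \<open>y\<close> by the transpose of \<open>V\<close>. Together they are fewer than
    \<open>n\<close>.\<close>
  define C where "C = unit_vec n ` ({..<n} - I) \<union> (\<lambda>s. V\<^sup>T *\<^sub>v s) ` S"
  have "card (unit_vec n ` ({..<n} - I) :: real vec set) \<le> n - card I"
    using card_image_le[of "{..<n} - I" "unit_vec n :: nat \<Rightarrow> real vec"] card_Diff_subset[OF fI I] by simp
  moreover have "card ((\<lambda>s. V\<^sup>T *\<^sub>v s) ` S) \<le> card S" using S(1) by (rule card_image_le)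
  moreover have "card C \<le> card (unit_vec n ` ({..<n} - I) :: real vec set) + card ((\<lambda>s. V\<^sup>T *\<^sub>v s) ` S)"
    unfolding C_def by (rule card_Un_le)
  moreover have "card I \<le> n" using card_mono[OF _ I] by simp
  ultimately have cC: "card C < n" using S(3) by linarith
  have "finite C" "C \<subseteq> carrier_vec n" using S D by (auto simp: C_def)
  from exists_nonzero_orthogonal[OF this cC]
  obtain y where y: "y \<in> carrier_vec n" "y \<noteq> 0\<^sub>v n" and yC: "\<And>s. s \<in> C \<Longrightarrow> s \<bullet> y = 0" by blast
  have supp: "y $ i = 0" if "i < n" "i \<notin> I" for i
    using yC[of "unit_vec n i"] that y(1) by (simp add: C_def)
  obtain j where j: "j < n" "y $ j \<noteq> 0" using nonzero_entry[OF y] by blast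
  show ?thesis
  proof
    show "V *\<^sub>v y \<in> carrier_vec n" using D y by simp
    show "V *\<^sub>v y \<noteq> 0\<^sub>v n" by (rule pair_diag_vec_nonzero[OF pd y])
    show "s \<bullet> (V *\<^sub>v y) = 0" if "s \<in> S" for s
    proof -
      have "(V\<^sup>T *\<^sub>v s) \<bullet> y = 0" using that by (intro yC) (simp add: C_def)
      moreover have "s \<in> carrier_vec n" using that S by auto
      ultimately show ?thesis using transpose_vec_mult_scalar[OF D(4) y(1)] by simp
    qed
    show "\<exists>i\<in>I. y $ i \<noteq> 0" using supp j by blast
    fix c
    have "(V *\<^sub>v y) \<bullet> (A *\<^sub>v (V *\<^sub>v y)) - c * ((V *\<^sub>v y) \<bullet> (P *\<^sub>v (V *\<^sub>v y)))
        = (\<Sum>i<n. (l i - c) * (y $ i)\<^sup>2)"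
      unfolding pair_diag_forms[OF pd y(1)] by (simp add: algebra_simps sum_subtractf sum_distrib_left)
    also have "\<dots> = (\<Sum>i\<in>I. (l i - c) * (y $ i)\<^sup>2)"
      by (rule sum.mono_neutral_right) (use I supp in auto)
    finally show "(V *\<^sub>v y) \<bullet> (A *\<^sub>v (V *\<^sub>v y)) - c * ((V *\<^sub>v y) \<bullet> (P *\<^sub>v (V *\<^sub>v y)))
        = (\<Sum>i\<in>I. (l i - c) * (y $ i)\<^sup>2)" .
  qed
qed

context
  fixes n P A V l and S :: "real vec set" and c :: real
  assumes pd: "pair_diag n P A V l" and S: "finite S" "S \<subseteq> carrier_vec n"
begin

text \<open>If more than \<open>card S\<close> eigenvalues exceeded \<open>c\<close>, the span of
  their eigenvectors would meet the subspace cut out by \<open>S\<close> in a nonzero vector. There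
  the form of \<open>A\<close> minus \<open>c\<close> times that of \<open>P\<close> is a sum of
  terms with positive weights, not all zero, against the assumed bound.\<close>

lemma card_eigenvalues_greater:
  assumes form: "\<And>x. x \<in> carrier_vec n \<Longrightarrow> x \<noteq> 0\<^sub>v n \<Longrightarrow> (\<And>s. s \<in> S \<Longrightarrow> s \<bullet> x = 0) \<Longrightarrow>
      x \<bullet> (A *\<^sub>v x) \<le> c * (x \<bullet> (P *\<^sub>v x))"
  shows "card {i. i < n \<and> c < l i} \<le> card S" (is "card ?I \<le> _")
proof (rule ccontr)
  assume "\<not> ?thesis"
  hence less: "card S < card ?I" by simp
  obtain x y where x: "x \<in> carrier_vec n" "x \<noteq> 0\<^sub>v n" "\<And>s. s \<in> S \<Longrightarrow> s \<bullet> x = 0"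
    "x \<bullet> (A *\<^sub>v x) - c * (x \<bullet> (P *\<^sub>v x)) = (\<Sum>i | i < n \<and> c < l i. (l i - c) * (y i)\<^sup>2)"
    "\<exists>i\<in>{i. i < n \<and> c < l i}. y i \<noteq> 0"
    by (rule pair_diag_restricted_vector[OF pd _ S less]) (auto intro: that)
  from x(5) obtain j where j: "j < n" "c < l j" "y j \<noteq> 0" by blast
  have "0 < (\<Sum>i | i < n \<and> c < l i. (l i - c) * (y i)\<^sup>2)"
    using j by (intro sum_pos2[of _ j]) auto
  with form[OF x(1-3)] x(4) show False by simp
qed

text \<open>Eigenvalues equal to \<open>c\<close> contribute nothing to the weighted sum, so it is
  only nonnegative; the contradiction comes from the strict inequality assumed for the form. Strict
  forms thus give counts that include the threshold itself.\<close>

lemma card_eigenvalues_geq: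
  assumes form: "\<And>x. x \<in> carrier_vec n \<Longrightarrow> x \<noteq> 0\<^sub>v n \<Longrightarrow> (\<And>s. s \<in> S \<Longrightarrow> s \<bullet> x = 0) \<Longrightarrow>
      x \<bullet> (A *\<^sub>v x) < c * (x \<bullet> (P *\<^sub>v x))"
  shows "card {i. i < n \<and> c \<le> l i} \<le> card S" (is "card ?I \<le> _")
proof (rule ccontr)
  assume "\<not> ?thesis"
  hence less: "card S < card ?I" by simp
  obtain x y where x: "x \<in> carrier_vec n" "x \<noteq> 0\<^sub>v n" "\<And>s. s \<in> S \<Longrightarrow> s \<bullet> x = 0"
    "x \<bullet> (A *\<^sub>v x) - c * (x \<bullet> (P *\<^sub>v x)) = (\<Sum>i | i < n \<and> c \<le> l i. (l i - c) * (y i)\<^sup>2)"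
    by (rule pair_diag_restricted_vector[OF pd _ S less]) (auto intro: that)
  have "0 \<le> (\<Sum>i | i < n \<and> c \<le> l i. (l i - c) * (y i)\<^sup>2)" by (intro sum_nonneg) auto
  with form[OF x(1-3)] x(4) show False by simp
qed

end

text \<open>Negation keeps \<open>V\<close> and the indexing of the eigenvalues, so every upper
  estimate yields a lower one for the same list \<open>l\<close>.\<close>

lemma pair_diag_uminus:
  assumes "pair_diag n P A V l"
  shows "pair_diag n P (- A) V (\<lambda>i. - l i)"
proof -
  note D = pair_diagD[OF assms]
  have "V\<^sup>T * (- A) * V = - (V\<^sup>T * A * V)" using D by simp
  also have "\<dots> = mat_diag n (\<lambda>i. - l i)"
    unfolding D(6) by (intro eq_matI) (auto simp: mat_diag_def)
  finally show ?thesis using D by (simp add: pair_diag_def)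
qed

lemma card_eigenvalues_less:
  assumes pd: "pair_diag n P A V l" and S: "finite S" "S \<subseteq> carrier_vec n"
    and form: "\<And>x. x \<in> carrier_vec n \<Longrightarrow> x \<noteq> 0\<^sub>v n \<Longrightarrow> (\<And>s. s \<in> S \<Longrightarrow> s \<bullet> x = 0) \<Longrightarrow>
      c * (x \<bullet> (P *\<^sub>v x)) \<le> x \<bullet> (A *\<^sub>v x)"
  shows "card {i. i < n \<and> l i < c} \<le> card S"
  using card_eigenvalues_greater[OF pair_diag_uminus[OF pd] S, of "- c"] form pair_diagD(3)[OF pd] by simp

lemma card_eigenvalues_leq:
  assumes pd: "pair_diag n P A V l" and S: "finite S" "S \<subseteq> carrier_vec n"
    and form: "\<And>x. x \<in> carrier_vec n \<Longrightarrow> x \<noteq> 0\<^sub>v n \<Longrightarrow> (\<And>s. s \<in> S \<Longrightarrow> s \<bullet> x = 0) \<Longrightarrow>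
      c * (x \<bullet> (P *\<^sub>v x)) < x \<bullet> (A *\<^sub>v x)"
  shows "card {i. i < n \<and> l i \<le> c} \<le> card S"
  using card_eigenvalues_geq[OF pair_diag_uminus[OF pd] S, of "- c"] form pair_diagD(3)[OF pd] by simp

section \<open>From a diagonalized pencil to the multiset of complex eigenvalues\<close>

lemma sum_singleton_lessThan:
  "(\<Sum>i<n. {#f i#}) = image_mset f (mset_set {..<n})" for n :: nat
  by (induction n) (auto simp: lessThan_Suc)

text \<open>The inverse of \<open>P\<close> is \<open>V * V\<^sup>T\<close>, hence
  \<open>P' * A\<close> equals \<open>V * mat_diag n l * (V\<^sup>T * P)\<close>, where the outer
  factors are inverse to each other. This is a similarity over the reals; the characteristic
  polynomial, carried over to the complex numbers, splits into the factors of the diagonal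
  matrix.\<close>

lemma eigvals_mset_pair_diag:
  assumes pd: "pair_diag n P A V l" and P': "P' \<in> carrier_mat n n" "P' * P = 1\<^sub>m n"
  shows "eigvals_mset (P' * A) = image_mset (\<lambda>i. complex_of_real (l i)) (mset_set {..<n})"
proof -
  note D = pair_diagD[OF pd]
  let ?L = "mat_diag n l"
  have inv: "V * (V\<^sup>T * P) = 1\<^sub>m n" by (rule pair_diag_inverse[OF pd])
  have PP': "P * P' = 1\<^sub>m n"
    by (rule mat_mult_left_right_inverse[OF P'(1) D(1) P'(2)])
  have "V * V\<^sup>T = (V * (V\<^sup>T * P)) * P'"
    using D P' PP' by (simp add: assoc_mult_mat[of _ n n _ n _ n])
  hence P'V: "P' = V * V\<^sup>T" unfolding inv using P' by simp
  have "P' * A = V * V\<^sup>T * A * (V * (V\<^sup>T * P))" unfolding inv P'V using D by simp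
  also have "\<dots> = V * (V\<^sup>T * A * V) * (V\<^sup>T * P)"
    using D(1-4) by (simp add: assoc_mult_mat[of _ n n _ n _ n])
  finally have eq: "P' * A = V * ?L * (V\<^sup>T * P)" unfolding D(6) .
  have "similar_mat (P' * A) ?L"
    by (rule similar_matI[of _ _ V "V\<^sup>T * P" n]) (use D P' inv eq in auto)
  hence "char_poly (P' * A) = char_poly ?L" by (rule char_poly_similar)
  moreover have "char_poly (complex_mat (P' * A)) = map_poly of_real (char_poly (P' * A))"
    using D P' by (intro of_real_hom.char_poly_hom[of _ n]) auto
  moreover have "char_poly (complex_mat ?L) = map_poly of_real (char_poly ?L)"
    by (intro of_real_hom.char_poly_hom[of _ n]) auto
  ultimately have "char_poly (complex_mat (P' * A)) = char_poly (complex_mat ?L)" by simp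
  also have "\<dots> = (\<Prod>a\<leftarrow>diag_mat (complex_mat ?L). [:- a, 1:])"
    by (rule char_poly_upper_triangular[of _ n]) (auto simp: mat_diag_def)
  also have "diag_mat (complex_mat ?L) = map (\<lambda>i. complex_of_real (l i)) [0..<n]"
    by (auto simp: diag_mat_def mat_diag_def)
  also have "(\<Prod>a\<leftarrow>\<dots>. [:- a, 1:]) = (\<Prod>i<n. [:- complex_of_real (l i), 1:])"
    by (simp add: prod.list_conv_set_nth lessThan_atLeast0 del: map_map)
  finally have "eigvals_mset (P' * A) = (\<Sum>i<n. {#complex_of_real (l i)#})"
    unfolding eigvals_mset_def by (simp add: proots_prod)
  also have "\<dots> = image_mset (\<lambda>i. complex_of_real (l i)) (mset_set {..<n})"
    by (rule sum_singleton_lessThan)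
  finally show ?thesis .
qed

section \<open>Positive semidefinite square roots\<close>

lemma psd_sqrt_exists:
  assumes B: "B \<in> carrier_mat n n" "sym_pos_semidef B"
  obtains S where "S \<in> carrier_mat n n" "sym_pos_semidef S" "S * S = B"
proof -
  have BT: "B\<^sup>T = B" and pos: "\<And>v. v \<in> carrier_vec n \<Longrightarrow> 0 \<le> v \<bullet> (B *\<^sub>v v)"
    using B by (auto simp: sym_pos_semidef_def)
  obtain U d where U: "U \<in> carrier_mat n n" "U\<^sup>T * U = 1\<^sub>m n" "U\<^sup>T * B * U = mat_diag n d"
    using real_spectral[OF B(1) BT] by blast
  have pdU: "pair_diag n (1\<^sub>m n) B U d" using U B by (simp add: pair_diag_def)
  have d: "d i \<ge> 0" if "i < n" for i
    using pos[of "col U i"] pair_diag_col(3)[OF pdU that] U(1) by (auto intro: carrier_vecI)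
  have UU: "U * U\<^sup>T = 1\<^sub>m n"
    by (rule mat_mult_left_right_inverse[OF _ U(1,2)]) (use U in simp)
  define E where "E = mat_diag n (\<lambda>i. sqrt (d i))"
  have E: "E \<in> carrier_mat n n" "E\<^sup>T = E" by (auto simp: E_def mat_diag_def)
  have EE: "E * E = U\<^sup>T * B * U"
    unfolding U(3) E_def mat_diag_diag using d by (intro eq_matI) (auto simp: mat_diag_def)
  define S where "S = U * E * U\<^sup>T"
  have S: "S \<in> carrier_mat n n" using U E by (simp add: S_def)
  have ST: "S\<^sup>T = S"
    using U(1) E by (simp add: S_def transpose_mult[of _ n n _ n])
  have form: "x \<bullet> (S *\<^sub>v x) \<ge> 0" if x: "x \<in> carrier_vec n" for x
  proof -
    have "x \<bullet> (S *\<^sub>v x) = (U\<^sup>T *\<^sub>v x) \<bullet> (E *\<^sub>v (U\<^sup>T *\<^sub>v x))"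
      unfolding S_def using U(1) E x by (subst congruence_form[of _ n]) auto
    also have "\<dots> = (\<Sum>i<n. sqrt (d i) * ((U\<^sup>T *\<^sub>v x) $ i * (U\<^sup>T *\<^sub>v x) $ i))"
      unfolding E_def using U(1) x by (intro mat_diag_form) auto
    also have "\<dots> \<ge> 0" using d by (intro sum_nonneg) simp
    finally show ?thesis .
  qed
  have "S * S = U * (E * ((U\<^sup>T * U) * E)) * U\<^sup>T"
    unfolding S_def using U(1) E by (simp add: assoc_mult_mat[of _ n n _ n _ n])
  also have "\<dots> = U * (U\<^sup>T * B * U) * U\<^sup>T"
    unfolding U(2) using E EE by simp
  also have "\<dots> = (U * U\<^sup>T) * B * (U * U\<^sup>T)"
    using U(1) B(1) by (simp add: assoc_mult_mat[of _ n n _ n _ n])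
  also have "\<dots> = B" unfolding UU using B by simp
  finally have "S * S = B" .
  with S ST form show ?thesis by (intro that[of S]) (auto simp: sym_pos_semidef_def)
qed

lemma square_form:
  fixes S :: "real mat"
  assumes "S \<in> carrier_mat n n" "S\<^sup>T = S" "x \<in> carrier_vec n"
  shows "x \<bullet> ((S * S) *\<^sub>v x) = (S *\<^sub>v x) \<bullet> (S *\<^sub>v x)"
  using assms symmetric_scalar_prod[of S n x "S *\<^sub>v x"]
  by (simp add: assoc_mult_mat_vec[of _ n n _ n])

text \<open>Let v be an eigenvector of the symmetric matrix \<open>S - R\<close> with eigenvalue e.
  Equal squares give |Sv| = |Rv|, so Sv - Rv = e v is orthogonal to Sv + Rv. If e were nonzero, both
  nonnegative numbers v \<bullet> Sv and v \<bullet> Rv would vanish, and so would their difference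
  e (v \<bullet> v). Uniqueness is what gives meaning to the definite description in
  \<open>mat_sqrt\<close>.\<close>

lemma psd_sqrt_unique:
  assumes S: "S \<in> carrier_mat n n" "sym_pos_semidef S"
    and R: "R \<in> carrier_mat n n" "sym_pos_semidef R" and eq: "S * S = R * R"
  shows "S = R"
proof -
  have ST: "S\<^sup>T = S" and Spos: "\<And>v. v \<in> carrier_vec n \<Longrightarrow> 0 \<le> v \<bullet> (S *\<^sub>v v)"
    using S by (auto simp: sym_pos_semidef_def)
  have RT: "R\<^sup>T = R" and Rpos: "\<And>v. v \<in> carrier_vec n \<Longrightarrow> 0 \<le> v \<bullet> (R *\<^sub>v v)"
    using R by (auto simp: sym_pos_semidef_def)
  define D where "D = S - R"
  have D: "D \<in> carrier_mat n n" using S R by (simp add: D_def minus_carrier_mat)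
  have "D\<^sup>T = D" using S(1) R(1) ST RT by (simp add: D_def transpose_minus)
  then obtain W e where W: "W \<in> carrier_mat n n" "W\<^sup>T * W = 1\<^sub>m n" "W\<^sup>T * D * W = mat_diag n e"
    using real_spectral[OF D] by blast
  have pd: "pair_diag n (1\<^sub>m n) D W e" using W D by (simp add: pair_diag_def)
  have "e i = 0" if i: "i < n" for i
  proof (rule ccontr)
    assume e: "e i \<noteq> 0"
    let ?v = "col W i"
    have v: "?v \<in> carrier_vec n" using W(1) by (auto intro: carrier_vecI)
    have c: "S *\<^sub>v ?v \<in> carrier_vec n" "R *\<^sub>v ?v \<in> carrier_vec n" using S R v by auto
    have Dv: "S *\<^sub>v ?v - R *\<^sub>v ?v = e i \<cdot>\<^sub>v ?v"
      using pair_diag_col(1)[OF pd i] S(1) R(1) v by (simp add: D_def minus_mult_distrib_mat_vec[of _ n n])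
    have "(S *\<^sub>v ?v) \<bullet> (S *\<^sub>v ?v) = (R *\<^sub>v ?v) \<bullet> (R *\<^sub>v ?v)"
      using square_form[OF S(1) ST v] square_form[OF R(1) RT v] eq by simp
    hence "(S *\<^sub>v ?v - R *\<^sub>v ?v) \<bullet> (S *\<^sub>v ?v + R *\<^sub>v ?v) = 0"
      using c comm_scalar_prod[OF c]
      by (simp add: minus_scalar_prod_distrib[of _ n] scalar_prod_add_distrib[of _ n])
    hence "e i * (?v \<bullet> (S *\<^sub>v ?v) + ?v \<bullet> (R *\<^sub>v ?v)) = 0"
      unfolding Dv using c v by (simp add: scalar_prod_add_distrib[of _ n] algebra_simps)
    hence "?v \<bullet> (S *\<^sub>v ?v) + ?v \<bullet> (R *\<^sub>v ?v) = 0" using e by simp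
    with Spos[OF v] Rpos[OF v] have "?v \<bullet> (S *\<^sub>v ?v) - ?v \<bullet> (R *\<^sub>v ?v) = 0" by linarith
    hence "?v \<bullet> (S *\<^sub>v ?v - R *\<^sub>v ?v) = 0" using c v by (simp add: scalar_prod_minus_distrib[of _ n])
    hence "e i * (?v \<bullet> ?v) = 0" unfolding Dv using v by simp
    moreover have "?v \<bullet> ?v = 1" using pair_diag_col(2)[OF pd i] v by simp
    ultimately show False using e by simp
  qed
  hence z: "W\<^sup>T * D * W = 0\<^sub>m n n" unfolding W(3) by (intro eq_matI) (auto simp: mat_diag_def)
  have WW: "W * W\<^sup>T = 1\<^sub>m n"
    by (rule mat_mult_left_right_inverse[OF _ W(1,2)]) (use W in simp)
  have "D = (W * W\<^sup>T) * D * (W * W\<^sup>T)" unfolding WW using D by simp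
  also have "\<dots> = W * (W\<^sup>T * D * W) * W\<^sup>T"
    using W(1) D by (simp add: assoc_mult_mat[of _ n n _ n _ n])
  finally have D0: "D = 0\<^sub>m n n" unfolding z using W by simp
  show ?thesis
  proof (rule eq_matI)
    fix i j assume "i < dim_row R" "j < dim_col R"
    thus "S $$ (i, j) = R $$ (i, j)"
      using arg_cong[OF D0, of "\<lambda>M. M $$ (i, j)"] S R by (simp add: D_def)
  qed (use S R in auto)
qed

lemma mat_sqrt:
  assumes B: "B \<in> carrier_mat n n" "sym_pos_semidef B"
  shows "mat_sqrt B \<in> carrier_mat n n" "sym_pos_semidef (mat_sqrt B)" "mat_sqrt B * mat_sqrt B = B"
proof -
  have "\<exists>!S. S \<in> carrier_mat (dim_row B) (dim_row B) \<and> sym_pos_semidef S \<and> S * S = B"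
    using B(1) psd_sqrt_exists[OF B] psd_sqrt_unique[of _ n] by (metis carrier_matD(1))
  from theI'[OF this] B(1)
  show "mat_sqrt B \<in> carrier_mat n n" "sym_pos_semidef (mat_sqrt B)" "mat_sqrt B * mat_sqrt B = B"
    unfolding mat_sqrt_def by auto
qed

text \<open>Order is compared on eigenvectors: there \<open>S * S\<close> acts as the square of
  \<open>s i\<close>, and c^2 < (s i)^2 with \<open>s i\<close> nonnegative implies c < s i. The
  bound then extends from the eigenvalues to all nonzero vectors.\<close>

lemma psd_form_gt:
  assumes S: "S \<in> carrier_mat n n" "sym_pos_semidef S"
    and sq: "\<And>x. x \<in> carrier_vec n \<Longrightarrow> x \<noteq> 0\<^sub>v n \<Longrightarrow> c\<^sup>2 * (x \<bullet> x) < x \<bullet> ((S * S) *\<^sub>v x)"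
    and x: "x \<in> carrier_vec n" "x \<noteq> 0\<^sub>v n"
  shows "c * (x \<bullet> x) < x \<bullet> (S *\<^sub>v x)"
proof -
  have ST: "S\<^sup>T = S" and pos: "\<And>v. v \<in> carrier_vec n \<Longrightarrow> 0 \<le> v \<bullet> (S *\<^sub>v v)"
    using S by (auto simp: sym_pos_semidef_def)
  obtain U s where U: "U \<in> carrier_mat n n" "U\<^sup>T * U = 1\<^sub>m n" "U\<^sup>T * S * U = mat_diag n s"
    using real_spectral[OF S(1) ST] by blast
  have pd: "pair_diag n (1\<^sub>m n) S U s" using U S by (simp add: pair_diag_def)
  have "c < s i" if i: "i < n" for i
  proof -
    let ?u = "col U i"
    have u: "?u \<in> carrier_vec n" using U(1) by (auto intro: carrier_vecI)
    have uu: "?u \<bullet> ?u = 1" using pair_diag_col(2)[OF pd i] u by simp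
    hence u0: "?u \<noteq> 0\<^sub>v n" using u by auto
    have Su: "S *\<^sub>v ?u = s i \<cdot>\<^sub>v ?u" using pair_diag_col(1)[OF pd i] u by simp
    have "s i \<ge> 0" using pos[OF u] pair_diag_col(3)[OF pd i] by simp
    moreover have "c\<^sup>2 < (s i)\<^sup>2"
      using sq[OF u u0] u uu unfolding square_form[OF S(1) ST u] Su by (simp add: power2_eq_square)
    ultimately show ?thesis by (rule power_less_imp_less_base[rotated])
  qed
  from pair_diag_form_gt[OF pd this x] x show ?thesis by simp
qed

section \<open>Perturbed pencils\<close>

text \<open>Half of the estimates; the other half is the same lemma for \<open>- H\<close>,
  \<open>- e\<close> and \<open>- l\<close>. \<open>S\<close> bounds the number of indices where the
  pencil of \<open>H\<close> and \<open>P\<close> has eigenvalue -1. The four claims come from four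
  comparisons of forms: A \<le> P where the coordinates with positive \<open>e\<close> vanish; A
  \<ge> P on the complement of the -1 eigenspace where also the coordinates with negative
  \<open>e\<close> vanish; A > P/2 on that complement; and A < 3P/2 on all nonzero vectors.\<close>

lemma eigenvalues_one_sided:
  fixes H :: "real mat"
  assumes pd: "pair_diag k P (H + mat_diag k e) V l"
    and H: "H \<in> carrier_mat k k" "H\<^sup>T = H" and HP: "H * H = P * P"
    and \<alpha>: "\<alpha> > 0" and Pgt: "\<forall>x\<in>carrier_vec k. x \<noteq> 0\<^sub>v k \<longrightarrow> \<alpha> * (x \<bullet> x) < x \<bullet> (P *\<^sub>v x)"
    and e: "\<forall>i<k. \<bar>e i\<bar> \<le> \<alpha> / 2"
    and S: "finite S" "S \<subseteq> carrier_vec k"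
    and HS: "\<forall>x\<in>carrier_vec k. x \<noteq> 0\<^sub>v k \<longrightarrow> (\<forall>s\<in>S. s \<bullet> x = 0) \<longrightarrow> 0 < x \<bullet> (H *\<^sub>v x)"
  shows "card {i. i < k \<and> 1 < l i} \<le> card {i. i < k \<and> 0 < e i}"
    and "card {i. i < k \<and> l i < 1} \<le> card S + card {i. i < k \<and> e i < 0}"
    and "card {i. i < k \<and> l i \<le> 1 / 2} \<le> card S"
    and "\<And>i. i < k \<Longrightarrow> l i < 3 / 2"
proof -
  let ?A = "H + mat_diag k e"
  note D = pair_diagD[OF pd]
  note P = Pgt[rule_format] and e = e[rule_format]
  have Ppos: "0 < x \<bullet> (P *\<^sub>v x)" if "x \<in> carrier_vec k" "x \<noteq> 0\<^sub>v k" for x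
    using P[OF that] mult_pos_pos[OF \<alpha> scalar_prod_self_pos[OF that]] by linarith
  have "sym_pos_def P" using D Ppos by (auto simp: sym_pos_def_def)
  then obtain W \<mu> where pdH: "pair_diag k P H W \<mu>"
    using pair_diag_exists[OF D(1) _ H] by blast
  have colW: "col W i \<in> carrier_vec k" for i
    using pair_diagD(4)[OF pdH] by (auto intro: carrier_vecI)
  have \<mu>: "\<mu> i = 1 \<or> \<mu> i = - 1" if i: "i < k" for i
  proof -
    let ?v = "col W i"
    let ?p = "P *\<^sub>v ?v"
    have p: "?p \<in> carrier_vec k" using D colW by simp
    have "?p \<noteq> 0\<^sub>v k" using pair_diag_col(2)[OF pdH i] colW[of i] by auto
    hence "?p \<bullet> ?p > 0" using scalar_prod_self_pos[OF p] by simp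
    moreover have "(H *\<^sub>v ?v) \<bullet> (H *\<^sub>v ?v) = ?p \<bullet> ?p"
      using square_form[OF H colW] square_form[OF D(1,2) colW] HP by simp
    hence "(\<mu> i)\<^sup>2 * (?p \<bullet> ?p) = ?p \<bullet> ?p"
      unfolding pair_diag_col(1)[OF pdH i] using p by (simp add: power2_eq_square)
    ultimately show ?thesis by (simp add: power2_eq_1_iff)
  qed
  have HleP: "x \<bullet> (H *\<^sub>v x) \<le> x \<bullet> (P *\<^sub>v x)" if x: "x \<in> carrier_vec k" for x
  proof -
    obtain y where y: "y \<in> carrier_vec k" "x = W *\<^sub>v y"
      using pair_diag_expand[OF pdH x] by blast
    have "\<mu> i * (y $ i)\<^sup>2 \<le> (y $ i)\<^sup>2" if "i < k" for i using \<mu>[OF that] by auto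
    thus ?thesis unfolding y(2) pair_diag_forms[OF pdH y(1)] by (intro sum_mono) auto
  qed
  \<comment> \<open>These are the indices with eigenvalue -1, written with \<open>\<le> 0\<close> so
    that the count with threshold 0 applies to them.\<close>
  define N where "N = {i. i < k \<and> \<mu> i \<le> 0}"
  have N: "finite N" "card N \<le> card S"
    unfolding N_def using card_eigenvalues_leq[OF pdH S, of 0] HS by auto
  \<comment> \<open>Each such vector reads off one coordinate with respect to \<open>W\<close>, so
    orthogonality to all of them removes the coordinates with eigenvalue -1. Only eigenvalue 1 is
    left, and the forms of \<open>H\<close> and \<open>P\<close> agree.\<close>
  define SN where "SN = (\<lambda>i. P *\<^sub>v col W i) ` N"
  have SN: "finite SN" "SN \<subseteq> carrier_vec k" "card SN \<le> card S"
    using N D colW card_image_le[OF N(1), of "\<lambda>i. P *\<^sub>v col W i"] by (auto simp: SN_def)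
  have HeqP: "x \<bullet> (H *\<^sub>v x) = x \<bullet> (P *\<^sub>v x)"
    if x: "x \<in> carrier_vec k" and orth: "\<And>s. s \<in> SN \<Longrightarrow> s \<bullet> x = 0" for x
  proof -
    obtain y where y: "y \<in> carrier_vec k" "x = W *\<^sub>v y"
        and yi: "\<And>i. i < k \<Longrightarrow> y $ i = (P *\<^sub>v col W i) \<bullet> x"
      using pair_diag_expand[OF pdH x] by blast
    have "\<mu> i * (y $ i)\<^sup>2 = (y $ i)\<^sup>2" if "i < k" for i
      using \<mu>[OF that] yi[OF that] orth[of "P *\<^sub>v col W i"] that by (auto simp: SN_def N_def)
    thus ?thesis unfolding y(2) pair_diag_forms[OF pdH y(1)] by (intro sum.cong) auto
  qed
  have A: "x \<bullet> (?A *\<^sub>v x) = x \<bullet> (H *\<^sub>v x) + (\<Sum>i<k. e i * (x $ i)\<^sup>2)"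
    if "x \<in> carrier_vec k" for x
  proof -
    have c: "mat_diag k e *\<^sub>v x \<in> carrier_vec k" "H *\<^sub>v x \<in> carrier_vec k"
      using that H by (auto intro: mult_mat_vec_carrier[of _ k k])
    have "?A *\<^sub>v x = H *\<^sub>v x + mat_diag k e *\<^sub>v x"
      by (rule add_mult_distrib_mat_vec[of _ k k]) (use H that in auto)
    thus ?thesis
      using c by (simp add: scalar_prod_add_distrib[OF that] mat_diag_form[OF that that] power2_eq_square)
  qed
  \<comment> \<open>The factor 1/2 is the ratio between the bound \<open>\<alpha> / 2\<close> on the
    entries of \<open>e\<close> and the strict lower bound \<open>\<alpha>\<close> of the form of
    \<open>P\<close>.\<close>
  have E: "\<bar>\<Sum>i<k. e i * (x $ i)\<^sup>2\<bar> < 1 / 2 * (x \<bullet> (P *\<^sub>v x))"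
    if "x \<in> carrier_vec k" "x \<noteq> 0\<^sub>v k" for x
  proof -
    have "\<bar>\<Sum>i<k. e i * (x $ i)\<^sup>2\<bar> \<le> (\<Sum>i<k. \<bar>e i * (x $ i)\<^sup>2\<bar>)" by (rule sum_abs)
    also have "\<dots> \<le> (\<Sum>i<k. \<alpha> / 2 * (x $ i)\<^sup>2)"
      using mult_right_mono[OF e] by (intro sum_mono) (simp add: abs_mult)
    also have "\<dots> = \<alpha> * (x \<bullet> x) / 2"
      using that by (simp add: scalar_prod_def sum_distrib_left sum_divide_distrib lessThan_atLeast0 power2_eq_square)
    also have "\<dots> < 1 / 2 * (x \<bullet> (P *\<^sub>v x))" using P[OF that] by simp
    finally show ?thesis .
  qed
  have unit: "x $ i = 0" if "x \<in> carrier_vec k" "i < k" "unit_vec k i \<bullet> x = 0" for x :: "real vec" and i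
    using that by simp

  let ?S = "unit_vec k ` {i. i < k \<and> 0 < e i} :: real vec set"
  have "card {i. i < k \<and> 1 < l i} \<le> card ?S"
  proof (rule card_eigenvalues_greater[OF pd])
    fix x assume x: "x \<in> carrier_vec k" "\<And>s. s \<in> ?S \<Longrightarrow> s \<bullet> x = 0"
    have "(\<Sum>i<k. e i * (x $ i)\<^sup>2) \<le> 0"
    proof (rule sum_nonpos)
      fix i assume "i \<in> {..<k}"
      thus "e i * (x $ i)\<^sup>2 \<le> 0"
        using unit[OF x(1), of i] x(2)[of "unit_vec k i"]
        by (cases "0 < e i") (auto simp: mult_nonpos_nonneg)
    qed
    thus "x \<bullet> (?A *\<^sub>v x) \<le> 1 * (x \<bullet> (P *\<^sub>v x))" using A[OF x(1)] HleP[OF x(1)] by simp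
  qed auto
  also have "card ?S \<le> card {i. i < k \<and> 0 < e i}" by (rule card_image_le) auto
  finally show "card {i. i < k \<and> 1 < l i} \<le> card {i. i < k \<and> 0 < e i}" .

  let ?S = "unit_vec k ` {i. i < k \<and> e i < 0} :: real vec set"
  have "card {i. i < k \<and> l i < 1} \<le> card (SN \<union> ?S)"
  proof (rule card_eigenvalues_less[OF pd])
    fix x assume x: "x \<in> carrier_vec k" "\<And>s. s \<in> SN \<union> ?S \<Longrightarrow> s \<bullet> x = 0"
    have "(\<Sum>i<k. e i * (x $ i)\<^sup>2) \<ge> 0"
    proof (rule sum_nonneg)
      fix i assume "i \<in> {..<k}"
      thus "0 \<le> e i * (x $ i)\<^sup>2"
        using unit[OF x(1), of i] x(2)[of "unit_vec k i"] by (cases "e i < 0") auto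
    qed
    thus "1 * (x \<bullet> (P *\<^sub>v x)) \<le> x \<bullet> (?A *\<^sub>v x)" using A[OF x(1)] HeqP[OF x(1)] x(2) by simp
  qed (use SN in auto)
  also have "\<dots> \<le> card SN + card ?S" by (rule card_Un_le)
  also have "card ?S \<le> card {i. i < k \<and> e i < 0}" by (rule card_image_le) auto
  finally show "card {i. i < k \<and> l i < 1} \<le> card S + card {i. i < k \<and> e i < 0}" using SN(3) by simp

  have "card {i. i < k \<and> l i \<le> 1 / 2} \<le> card SN"
  proof (rule card_eigenvalues_leq[OF pd SN(1,2)])
    fix x assume x: "x \<in> carrier_vec k" "x \<noteq> 0\<^sub>v k" "\<And>s. s \<in> SN \<Longrightarrow> s \<bullet> x = 0"
    show "1 / 2 * (x \<bullet> (P *\<^sub>v x)) < x \<bullet> (?A *\<^sub>v x)"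
      using A[OF x(1)] HeqP[OF x(1,3)] E[OF x(1,2)] by (simp add: abs_less_iff)
  qed
  thus "card {i. i < k \<and> l i \<le> 1 / 2} \<le> card S" using SN(3) by simp

  fix i assume i: "i < k"
  let ?v = "col V i"
  have v: "?v \<in> carrier_vec k" using D(4) by (auto intro: carrier_vecI)
  have "?v \<noteq> 0\<^sub>v k" using pair_diag_col(2)[OF pd i] D v by auto
  thus "l i < 3 / 2"
    using pair_diag_col(2,3)[OF pd i] A[OF v] HleP[OF v] E[OF v] by (simp add: abs_less_iff)
qed

text \<open>A squeeze determines the inertia. At most \<open>N\<close> of the \<open>2 * N\<close>
  eigenvalues are \<le> 1/2, so at least \<open>N\<close> are > 1/2; by reflection at most
  \<open>N\<close> are \<ge> -1/2. The set of indices above 1/2 lies inside the other one, so the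
  two coincide, the interval [-1/2, 1/2] is free of eigenvalues, and exactly \<open>N\<close> are
  positive.\<close>

lemma perturbed_pencil_spectrum:
  fixes H :: "real mat"
  assumes P: "P \<in> carrier_mat (2 * N) (2 * N)" "P\<^sup>T = P"
    and H: "H \<in> carrier_mat (2 * N) (2 * N)" "H\<^sup>T = H" and HP: "H * H = P * P"
    and \<alpha>: "\<alpha> > 0" and Pgt: "\<forall>x\<in>carrier_vec (2 * N). x \<noteq> 0\<^sub>v (2 * N) \<longrightarrow> \<alpha> * (x \<bullet> x) < x \<bullet> (P *\<^sub>v x)"
    and e: "\<forall>i<2 * N. \<bar>e i\<bar> \<le> \<alpha> / 2"
    and epos: "card {i. i < 2 * N \<and> 0 < e i} \<le> m" and eneg: "card {i. i < 2 * N \<and> e i < 0} \<le> m"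
    and S: "finite S" "S \<subseteq> carrier_vec (2 * N)" "card S \<le> N"
    and HS: "\<forall>x\<in>carrier_vec (2 * N). x \<noteq> 0\<^sub>v (2 * N) \<longrightarrow> (\<forall>s\<in>S. s \<bullet> x = 0) \<longrightarrow> 0 < x \<bullet> (H *\<^sub>v x)"
    and S': "finite S'" "S' \<subseteq> carrier_vec (2 * N)" "card S' \<le> N"
    and HS': "\<forall>x\<in>carrier_vec (2 * N). x \<noteq> 0\<^sub>v (2 * N) \<longrightarrow> (\<forall>s\<in>S'. s \<bullet> x = 0) \<longrightarrow> x \<bullet> (H *\<^sub>v x) < 0"
  obtains V l where "pair_diag (2 * N) P (H + mat_diag (2 * N) e) V l"
    and "\<And>i. i < 2 * N \<Longrightarrow> 1 / 2 < l i \<and> l i < 3 / 2 \<or> - 3 / 2 < l i \<and> l i < - 1 / 2"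
    and "card {i. i < 2 * N \<and> 1 < l i} \<le> m" "card {i. i < 2 * N \<and> l i < - 1} \<le> m"
    and "card {i. i < 2 * N \<and> 0 < l i \<and> l i < 1} \<le> m"
    and "card {i. i < 2 * N \<and> - 1 < l i \<and> l i < 0} \<le> m"
    and "card {i. i < 2 * N \<and> 0 < l i} = N" "card {i. i < 2 * N \<and> l i < 0} = N"
proof -
  let ?k = "2 * N"
  let ?A = "H + mat_diag ?k e"
  have Ppos: "0 < x \<bullet> (P *\<^sub>v x)" if "x \<in> carrier_vec ?k" "x \<noteq> 0\<^sub>v ?k" for x
    using Pgt[rule_format, OF that] mult_pos_pos[OF \<alpha> scalar_prod_self_pos[OF that]] by linarith
  have spd: "sym_pos_def P" using P Ppos by (auto simp: sym_pos_def_def)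
  have A: "?A \<in> carrier_mat ?k ?k" by simp
  have DT: "(mat_diag ?k e)\<^sup>T = mat_diag ?k e" by (auto simp: mat_diag_def)
  have "?A\<^sup>T = H\<^sup>T + (mat_diag ?k e)\<^sup>T"
    by (rule transpose_add) (use H in auto)
  hence AT: "?A\<^sup>T = ?A" unfolding DT H(2) .
  obtain V l where pd: "pair_diag ?k P ?A V l"
    using pair_diag_exists[OF P(1) spd A AT] by blast
  have neg: "- ?A = - H + mat_diag ?k (\<lambda>i. - e i)"
    using H by (intro eq_matI) (auto simp: mat_diag_def)
  have pd': "pair_diag ?k P (- H + mat_diag ?k (\<lambda>i. - e i)) V (\<lambda>i. - l i)"
    using pair_diag_uminus[OF pd] unfolding neg .
  note up = eigenvalues_one_sided[OF pd H HP \<alpha> Pgt e S(1,2) HS]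
  have mH: "- H \<in> carrier_mat ?k ?k" "(- H)\<^sup>T = - H" "- H * - H = P * P"
    using H HP by (auto simp: transpose_uminus)
  have HS'': "\<forall>x\<in>carrier_vec ?k. x \<noteq> 0\<^sub>v ?k \<longrightarrow> (\<forall>s\<in>S'. s \<bullet> x = 0) \<longrightarrow> 0 < x \<bullet> (- H *\<^sub>v x)"
    using HS' H by simp
  have e': "\<forall>i<?k. \<bar>- e i\<bar> \<le> \<alpha> / 2" using e by simp
  \<comment> \<open>Under the reflection the entries of \<open>e\<close> change sign, so positive
    and negative ones exchange roles in the bounds, and \<open>S'\<close> takes the place of
    \<open>S\<close>.\<close>
  note down = eigenvalues_one_sided[OF pd' mH \<alpha> Pgt e' S'(1,2) HS'']
  have down1: "card {i. i < ?k \<and> l i < - 1} \<le> card {i. i < ?k \<and> e i < 0}"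
    using down(1) by (simp add: less_minus_iff[of 1])
  have down2: "card {i. i < ?k \<and> - 1 < l i} \<le> card S' + card {i. i < ?k \<and> 0 < e i}"
    using down(2) by (simp add: minus_less_iff[of _ 1])
  have down3: "card {i. i < ?k \<and> - (1 / 2) \<le> l i} \<le> card S'"
    using down(3) by (simp only: minus_le_iff[of _ "1 / 2"])
  have "{i. i < ?k \<and> l i \<le> 1 / 2} \<union> {i. i < ?k \<and> 1 / 2 < l i} = {..<?k}" by auto
  hence "2 * N \<le> card {i. i < ?k \<and> l i \<le> 1 / 2} + card {i. i < ?k \<and> 1 / 2 < l i}"
    using card_Un_le[of "{i. i < ?k \<and> l i \<le> 1 / 2}" "{i. i < ?k \<and> 1 / 2 < l i}"] by simp
  hence half: "N \<le> card {i. i < ?k \<and> 1 / 2 < l i}" using up(3) S(3) by linarith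
  have sub: "{i. i < ?k \<and> 1 / 2 < l i} \<subseteq> {i. i < ?k \<and> - (1 / 2) \<le> l i}" by auto
  have le: "card {i. i < ?k \<and> - (1 / 2) \<le> l i} \<le> N" using down3 S'(3) by linarith
  have eqs: "{i. i < ?k \<and> 1 / 2 < l i} = {i. i < ?k \<and> - (1 / 2) \<le> l i}"
    by (rule card_seteq[OF _ sub]) (use half le in auto)
  have gap: "1 / 2 < l i \<or> l i < - (1 / 2)" if "i < ?k" for i
  proof (cases "- (1 / 2) \<le> l i")
    case True
    with that have "i \<in> {i. i < ?k \<and> - (1 / 2) \<le> l i}" by simp
    thus ?thesis unfolding eqs[symmetric] by simp
  qed simp
  have pos: "{i. i < ?k \<and> 0 < l i} = {i. i < ?k \<and> 1 / 2 < l i}" using gap by force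
  have cpos: "card {i. i < ?k \<and> 0 < l i} = N"
    unfolding pos using half le unfolding eqs by simp
  have split: "{i. i < ?k \<and> 0 < l i} \<union> {i. i < ?k \<and> l i < 0} = {..<?k}" using gap by force
  have "card ({i. i < ?k \<and> 0 < l i} \<union> {i. i < ?k \<and> l i < 0})
      = card {i. i < ?k \<and> 0 < l i} + card {i. i < ?k \<and> l i < 0}"
    by (rule card_Un_disjoint) auto
  hence cneg: "card {i. i < ?k \<and> l i < 0} = N" using cpos unfolding split by simp
  \<comment> \<open>The bound \<open>N + m\<close> for eigenvalues below 1 includes the
    \<open>N\<close> negative ones; subtracting them leaves \<open>m\<close> for the interval (0,
    1).\<close>
  have "{i. i < ?k \<and> l i < 1} = {i. i < ?k \<and> l i < 0} \<union> {i. i < ?k \<and> 0 < l i \<and> l i < 1}"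
    using gap by force
  moreover have "card ({i. i < ?k \<and> l i < 0} \<union> {i. i < ?k \<and> 0 < l i \<and> l i < 1})
      = card {i. i < ?k \<and> l i < 0} + card {i. i < ?k \<and> 0 < l i \<and> l i < 1}"
    by (rule card_Un_disjoint) auto
  ultimately have in_pos: "card {i. i < ?k \<and> 0 < l i \<and> l i < 1} \<le> m"
    using cneg up(2) S(3) eneg by simp
  have "{i. i < ?k \<and> - 1 < l i} = {i. i < ?k \<and> 0 < l i} \<union> {i. i < ?k \<and> - 1 < l i \<and> l i < 0}"
    using gap by force
  moreover have "card ({i. i < ?k \<and> 0 < l i} \<union> {i. i < ?k \<and> - 1 < l i \<and> l i < 0})
      = card {i. i < ?k \<and> 0 < l i} + card {i. i < ?k \<and> - 1 < l i \<and> l i < 0}"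
    by (rule card_Un_disjoint) auto
  ultimately have in_neg: "card {i. i < ?k \<and> - 1 < l i \<and> l i < 0} \<le> m"
    using cpos down2 S'(3) epos by simp
  show ?thesis
  proof (rule that[OF pd _ _ _ in_pos in_neg cpos cneg])
    show "1 / 2 < l i \<and> l i < 3 / 2 \<or> - 3 / 2 < l i \<and> l i < - 1 / 2" if "i < ?k" for i
      using gap[OF that] up(4)[OF that] down(4)[OF that] by auto
    show "card {i. i < ?k \<and> 1 < l i} \<le> m" using up(1) epos by linarith
    show "card {i. i < ?k \<and> l i < - 1} \<le> m" using down1 eneg by linarith
  qed
qed

section \<open>Block Toeplitz and saddle point matrices\<close>

lemma block_toeplitz_carrier:
  assumes "\<Delta> \<in> carrier_mat m m"
  shows "B1 n \<otimes>\<^sub>k 1\<^sub>m m - c \<cdot>\<^sub>m (B2 n \<otimes>\<^sub>k \<Delta>) \<in> carrier_mat (n * m) (n * m)"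
  using assms by (intro carrier_matI) (auto simp: kron_def B1_def B2_def)

lemma block_index_less: "a < n \<Longrightarrow> b < m \<Longrightarrow> a * m + b < n * (m :: nat)"
  using mult_le_mono1[of "Suc a" n m] by simp

lemma mult_mat_vec_entry:
  assumes "A \<in> carrier_mat nr nc" "x \<in> carrier_vec nc" "i < nr"
  shows "(A *\<^sub>v x) $ i = (\<Sum>j<nc. A $$ (i, j) * x $ j)"
  using assms by (simp add: scalar_prod_def lessThan_atLeast0)

lemma sum_shift_lessThan:
  fixes f :: "nat \<Rightarrow> 'a :: comm_monoid_add"
  shows "sum f {k..<k + m} = (\<Sum>b<m. f (k + b))"
  by (induction m) auto

text \<open>Forward substitution over the blocks: when all earlier blocks of \<open>x\<close>
  vanish, block row a reads w = c \<Delta> w. Then w \<bullet> w = c (w \<bullet> \<Delta> w), which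
  is at most 0 because \<Delta> is negative definite, so w = 0.\<close>

lemma block_toeplitz_injective:
  assumes \<Delta>: "\<Delta> \<in> carrier_mat m m" "sym_pos_def (- \<Delta>)" and c: "c \<ge> 0"
    and x: "x \<in> carrier_vec (n * m)"
    and Tx: "(B1 n \<otimes>\<^sub>k 1\<^sub>m m - c \<cdot>\<^sub>m (B2 n \<otimes>\<^sub>k \<Delta>)) *\<^sub>v x = 0\<^sub>v (n * m)"
  shows "x = 0\<^sub>v (n * m)"
proof -
  let ?T = "B1 n \<otimes>\<^sub>k 1\<^sub>m m - c \<cdot>\<^sub>m (B2 n \<otimes>\<^sub>k \<Delta>)"
  have T: "?T \<in> carrier_mat (n * m) (n * m)" by (rule block_toeplitz_carrier[OF \<Delta>(1)])
  have Tij: "?T $$ (i, j) = B1 n $$ (i div m, j div m) * 1\<^sub>m m $$ (i mod m, j mod m)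
      - c * (B2 n $$ (i div m, j div m) * \<Delta> $$ (i mod m, j mod m))"
    if "i < n * m" "j < n * m" for i j
    using that \<Delta> by (simp add: kron_def B1_def B2_def)
  have blocks: "\<forall>b<m. x $ (a * m + b) = 0" if "a < n" for a
    using that
  proof (induction a rule: less_induct)
    case (less a)
    let ?w = "vec m (\<lambda>b. x $ (a * m + b))"
    have w: "?w \<in> carrier_vec m" by simp
    have row: "?w $ b = c * (\<Delta> *\<^sub>v ?w) $ b" if b: "b < m" for b
    proof -
      let ?f = "\<lambda>j. ?T $$ (a * m + b, j) * x $ j"
      have i: "a * m + b < n * m" by (rule block_index_less[OF less.prems b])
      have "0 = (?T *\<^sub>v x) $ (a * m + b)" unfolding Tx using i by simp
      also have "\<dots> = (\<Sum>j<n * m. ?f j)"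
        by (rule mult_mat_vec_entry[OF T x i])
      also have "\<dots> = (\<Sum>a'<n. \<Sum>j\<in>{a' * m..<a' * m + m}. ?f j)"
        by (rule sum.nat_group[symmetric])
      also have "\<dots> = (\<Sum>j\<in>{a * m..<a * m + m}. ?f j)"
      proof -
        \<comment> \<open>Blocks before a vanish by the induction hypothesis on \<open>x\<close>,
          blocks after a because both Toeplitz factors are lower triangular.\<close>
        have "(\<Sum>j\<in>{a' * m..<a' * m + m}. ?f j) = 0" if a': "a' < n" "a' \<noteq> a" for a'
        proof (rule sum.neutral, intro ballI)
          fix j assume j: "j \<in> {a' * m..<a' * m + m}"
          define b' where "b' = j - a' * m"
          have jb: "j = a' * m + b'" "b' < m" using j by (auto simp: b'_def)
          have j': "j < n * m" unfolding jb(1) by (rule block_index_less[OF a'(1) jb(2)])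
          show "?f j = 0"
          proof (cases "a' < a")
            case True
            hence "x $ j = 0" using less.IH[OF True a'(1)] jb by simp
            thus ?thesis by simp
          next
            case False
            hence "a < a'" using a' by simp
            thus ?thesis unfolding Tij[OF i j'] using a' less.prems b jb
              by (simp add: B1_def B2_def)
          qed
        qed
        hence "(\<Sum>a'\<in>{..<n} - {a}. \<Sum>j\<in>{a' * m..<a' * m + m}. ?f j) = 0"
          by (intro sum.neutral) auto
        thus ?thesis using less.prems by (subst sum.remove[of _ a]) auto
      qed
      also have "\<dots> = (\<Sum>b'<m. ?f (a * m + b'))"
        by (rule sum_shift_lessThan)
      also have "\<dots> = (\<Sum>b'<m. (if b' = b then x $ (a * m + b) else 0) - c * (\<Delta> $$ (b, b') * x $ (a * m + b')))"
      proof (rule sum.cong[OF refl])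
        fix b' assume "b' \<in> {..<m}"
        hence b': "b' < m" by simp
        show "?f (a * m + b') = (if b' = b then x $ (a * m + b) else 0) - c * (\<Delta> $$ (b, b') * x $ (a * m + b'))"
          unfolding Tij[OF i block_index_less[OF less.prems b']] using less.prems b b'
          by (simp add: B1_def B2_def algebra_simps)
      qed
      also have "\<dots> = ?w $ b - c * (\<Delta> *\<^sub>v ?w) $ b"
        using b \<Delta>(1) by (simp add: sum_subtractf scalar_prod_def lessThan_atLeast0 sum_distrib_left)
      finally show ?thesis by simp
    qed
    have "?w \<bullet> ?w = c * (?w \<bullet> (\<Delta> *\<^sub>v ?w))"
    proof -
      have "?w = c \<cdot>\<^sub>v (\<Delta> *\<^sub>v ?w)" using \<Delta>(1) row by (intro eq_vecI) auto
      hence "?w \<bullet> ?w = ?w \<bullet> (c \<cdot>\<^sub>v (\<Delta> *\<^sub>v ?w))" by simp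
      thus ?thesis using \<Delta>(1) w by simp
    qed
    moreover have "?w \<bullet> (\<Delta> *\<^sub>v ?w) < 0" if "?w \<noteq> 0\<^sub>v m"
      using \<Delta> that w by (auto simp: sym_pos_def_def)
    ultimately have "?w = 0\<^sub>v m"
      using scalar_prod_self_pos[OF w] c by (metis mult_nonneg_nonpos less_imp_le not_le)
    hence "?w $ b = 0" if "b < m" for b using that by simp
    thus ?case by simp
  qed
  show ?thesis
  proof (rule eq_vecI)
    fix i assume "i < dim_vec (0\<^sub>v (n * m) :: real vec)"
    hence i: "i < n * m" by simp
    hence "m > 0" by (cases m) auto
    hence "i div m < n" "i mod m < m" using i by (auto simp: less_mult_imp_div_less)
    from blocks[OF this(1)] this(2) have "x $ (i div m * m + i mod m) = 0" by blast
    thus "x $ i = 0\<^sub>v (n * m) $ i" using i by simp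
  qed (use x in auto)
qed

section \<open>Square roots of shifted Gram matrices\<close>

lemma smult_one_mult_mat_vec:
  fixes w :: "'a :: comm_ring_1 vec"
  assumes "w \<in> carrier_vec n"
  shows "(c \<cdot>\<^sub>m 1\<^sub>m n) *\<^sub>v w = c \<cdot>\<^sub>v w"
  using assms by (intro eq_vecI) auto

text \<open>The form of \<open>B\<close> is |Fx|^2 + \<alpha>^2 |x|^2. Injectivity makes the first
  summand positive for nonzero \<open>x\<close>, so \<open>B\<close> exceeds \<alpha>^2 strictly and
  its root exceeds \<alpha>. The lemma serves a matrix and its transpose alike and so covers both
  diagonal blocks.\<close>

lemma gram_sqrt:
  fixes F :: "real mat" and \<alpha> :: real
  assumes F: "F \<in> carrier_mat n n" and inj: "\<And>x. x \<in> carrier_vec n \<Longrightarrow> F *\<^sub>v x = 0\<^sub>v n \<Longrightarrow> x = 0\<^sub>v n"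
  defines "B \<equiv> F\<^sup>T * F + \<alpha>\<^sup>2 \<cdot>\<^sub>m 1\<^sub>m n"
  shows "mat_sqrt B \<in> carrier_mat n n" "(mat_sqrt B)\<^sup>T = mat_sqrt B" "mat_sqrt B * mat_sqrt B = B"
    and "\<And>x. x \<in> carrier_vec n \<Longrightarrow> x \<noteq> 0\<^sub>v n \<Longrightarrow> \<alpha> * (x \<bullet> x) < x \<bullet> (mat_sqrt B *\<^sub>v x)"
proof -
  have B: "B \<in> carrier_mat n n" using F by (simp add: B_def)
  have BT: "B\<^sup>T = B"
  proof -
    have "B\<^sup>T = (F\<^sup>T * F)\<^sup>T + (\<alpha>\<^sup>2 \<cdot>\<^sub>m 1\<^sub>m n)\<^sup>T"
      unfolding B_def using F by (intro transpose_add[of _ n n]) auto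
    also have "(F\<^sup>T * F)\<^sup>T = F\<^sup>T * F" using F by (simp add: transpose_mult[of _ n n _ n])
    also have "(\<alpha>\<^sup>2 \<cdot>\<^sub>m 1\<^sub>m n)\<^sup>T = \<alpha>\<^sup>2 \<cdot>\<^sub>m 1\<^sub>m n" by (intro eq_matI) auto
    finally show ?thesis by (simp add: B_def)
  qed
  have form: "x \<bullet> (B *\<^sub>v x) = (F *\<^sub>v x) \<bullet> (F *\<^sub>v x) + \<alpha>\<^sup>2 * (x \<bullet> x)" if x: "x \<in> carrier_vec n" for x
  proof -
    have c: "F *\<^sub>v x \<in> carrier_vec n" "F\<^sup>T *\<^sub>v (F *\<^sub>v x) \<in> carrier_vec n" using F x by auto
    have "(\<alpha>\<^sup>2 \<cdot>\<^sub>m 1\<^sub>m n) *\<^sub>v x = \<alpha>\<^sup>2 \<cdot>\<^sub>v x"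
      by (rule smult_one_mult_mat_vec[OF x])
    hence "B *\<^sub>v x = F\<^sup>T *\<^sub>v (F *\<^sub>v x) + \<alpha>\<^sup>2 \<cdot>\<^sub>v x"
      unfolding B_def using F x
      by (subst add_mult_distrib_mat_vec[of _ n n]) (auto simp: assoc_mult_mat_vec[of _ n n _ n])
    moreover have "x \<bullet> (F\<^sup>T *\<^sub>v (F *\<^sub>v x)) = (F *\<^sub>v x) \<bullet> (F *\<^sub>v x)"
      using comm_scalar_prod[OF x c(2)] transpose_vec_mult_scalar[OF F x c(1)] by simp
    ultimately show ?thesis using c x by (simp add: scalar_prod_add_distrib[of _ n])
  qed
  have psd: "sym_pos_semidef B"
    using B BT form scalar_prod_self_nonneg by (auto simp: sym_pos_semidef_def)
  note S = mat_sqrt[OF B psd]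
  show "mat_sqrt B \<in> carrier_mat n n" "(mat_sqrt B)\<^sup>T = mat_sqrt B" "mat_sqrt B * mat_sqrt B = B"
    using S by (auto simp: sym_pos_semidef_def)
  have gt: "\<alpha>\<^sup>2 * (x \<bullet> x) < x \<bullet> (mat_sqrt B * mat_sqrt B *\<^sub>v x)"
    if x: "x \<in> carrier_vec n" "x \<noteq> 0\<^sub>v n" for x
    unfolding S(3) form[OF x(1)] using scalar_prod_self_pos[of "F *\<^sub>v x" n] inj[OF x(1)] x F by auto
  show "\<alpha> * (x \<bullet> x) < x \<bullet> (mat_sqrt B *\<^sub>v x)" if "x \<in> carrier_vec n" "x \<noteq> 0\<^sub>v n" for x
    by (rule psd_form_gt[OF S(1,2) gt that])
qed

lemma transpose_injective:
  fixes F :: "real mat"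
  assumes F: "F \<in> carrier_mat n n" and inj: "\<And>x. x \<in> carrier_vec n \<Longrightarrow> F *\<^sub>v x = 0\<^sub>v n \<Longrightarrow> x = 0\<^sub>v n"
    and x: "x \<in> carrier_vec n" "F\<^sup>T *\<^sub>v x = 0\<^sub>v n"
  shows "x = 0\<^sub>v n"
proof -
  have "det F \<noteq> 0" using det_0_iff_vec_prod_zero[OF F] inj by blast
  hence "det (F\<^sup>T) \<noteq> 0" using det_transpose[OF F] by simp
  moreover have "F\<^sup>T \<in> carrier_mat n n" using F by simp
  ultimately show ?thesis using det_0_iff_vec_prod_zero[of "F\<^sup>T" n] x by blast
qed

lemma mat_inv_left:
  assumes P: "P \<in> carrier_mat n n" and inj: "\<And>x. x \<in> carrier_vec n \<Longrightarrow> P *\<^sub>v x = 0\<^sub>v n \<Longrightarrow> x = 0\<^sub>v n"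
  shows "mat_inv P \<in> carrier_mat n n" "mat_inv P * P = 1\<^sub>m n"
proof -
  have "det P \<noteq> 0" using det_0_iff_vec_prod_zero[OF P] inj by blast
  hence "P \<in> Units (ring_mat TYPE(real) n ())" by (rule det_non_zero_imp_unit[OF P])
  then obtain Q where "mat_inverse P = Some Q" using mat_inverse(1)[OF P, of "()"] by (cases "mat_inverse P") auto
  from mat_inverse(2)[OF P this] this
  show "mat_inv P \<in> carrier_mat n n" "mat_inv P * P = 1\<^sub>m n" by (auto simp: mat_inv_def)
qed

lemma kron_mat_diag_one: "mat_diag n f \<otimes>\<^sub>k 1\<^sub>m m = mat_diag (n * m) (\<lambda>i. f (i div m))"
proof (rule eq_matI)
  fix i j assume ij: "i < dim_row (mat_diag (n * m) (\<lambda>i. f (i div m)))"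
    "j < dim_col (mat_diag (n * m) (\<lambda>i. f (i div m)))"
  hence ij: "i < n * m" "j < n * m" by (auto simp: mat_diag_def)
  hence m: "m > 0" by (cases m) auto
  have d: "i div m < n" "j div m < n" using ij by (auto simp: less_mult_imp_div_less)
  have "i = j \<longleftrightarrow> i div m = j div m \<and> i mod m = j mod m" by (metis div_mult_mod_eq)
  thus "(mat_diag n f \<otimes>\<^sub>k 1\<^sub>m m) $$ (i, j) = mat_diag (n * m) (\<lambda>i. f (i div m)) $$ (i, j)"
    using ij m d by (auto simp: kron_def mat_diag_def)
qed (auto simp: kron_def mat_diag_def)

section \<open>The saddle point matrix with scalar diagonal blocks and its block diagonal
  modulus\<close>

context
  fixes N :: nat and F S R :: "real mat" and \<alpha> :: real and H P
  assumes F: "F \<in> carrier_mat N N" and S: "S \<in> carrier_mat N N" and R: "R \<in> carrier_mat N N"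
  defines "H \<equiv> four_block_mat (\<alpha> \<cdot>\<^sub>m 1\<^sub>m N) (F\<^sup>T) F (- (\<alpha> \<cdot>\<^sub>m 1\<^sub>m N))"
    and "P \<equiv> four_block_mat S (0\<^sub>m N N) (0\<^sub>m N N) R"
begin

lemma saddle_dims: "H \<in> carrier_mat (2 * N) (2 * N)" "P \<in> carrier_mat (2 * N) (2 * N)"
  using F S R by (auto simp: H_def P_def mult_2)

lemma saddle_symmetric: "H\<^sup>T = H"
proof -
  have "(- (\<alpha> \<cdot>\<^sub>m 1\<^sub>m N))\<^sup>T = - (\<alpha> \<cdot>\<^sub>m 1\<^sub>m N)" "(\<alpha> \<cdot>\<^sub>m 1\<^sub>m N)\<^sup>T = \<alpha> \<cdot>\<^sub>m 1\<^sub>m N"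
    by (auto intro!: eq_matI)
  thus ?thesis unfolding H_def using F by (subst transpose_four_block_mat[of _ N N _ N _ N]) auto
qed

lemma block_diag_symmetric:
  assumes "S\<^sup>T = S" "R\<^sup>T = R"
  shows "P\<^sup>T = P"
  unfolding P_def using S R assms
  by (subst transpose_four_block_mat[of _ N N _ N _ N]) (auto simp: zero_transpose_mat)

text \<open>The off-diagonal blocks of \<open>H * H\<close> are \<alpha> times
  \<open>F\<^sup>T\<close> minus itself and \<alpha> times \<open>F\<close> minus itself. With the
  halved blocks of the original diagonal this cancellation fails in general.\<close>

lemma saddle_square:
  assumes "S * S = F\<^sup>T * F + \<alpha>\<^sup>2 \<cdot>\<^sub>m 1\<^sub>m N" "R * R = F * F\<^sup>T + \<alpha>\<^sup>2 \<cdot>\<^sub>m 1\<^sub>m N"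
  shows "H * H = P * P"
proof -
  have neg: "- (\<alpha> \<cdot>\<^sub>m 1\<^sub>m N) * - (\<alpha> \<cdot>\<^sub>m 1\<^sub>m N) = \<alpha>\<^sup>2 \<cdot>\<^sub>m 1\<^sub>m N"
    "(\<alpha> \<cdot>\<^sub>m 1\<^sub>m N) * (\<alpha> \<cdot>\<^sub>m 1\<^sub>m N) = \<alpha>\<^sup>2 \<cdot>\<^sub>m 1\<^sub>m N"
    by (auto intro!: eq_matI simp: power2_eq_square)
  have id: "- (\<alpha> \<cdot>\<^sub>m 1\<^sub>m N) = (- \<alpha>) \<cdot>\<^sub>m 1\<^sub>m N" by (intro eq_matI) auto
  have l: "(c \<cdot>\<^sub>m 1\<^sub>m N) * M = c \<cdot>\<^sub>m M" "M * (c \<cdot>\<^sub>m 1\<^sub>m N) = c \<cdot>\<^sub>m M"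
    if "M \<in> carrier_mat N N" for M :: "real mat" and c
    using that by (auto simp: mult_smult_assoc_mat[of _ N N _ N] mult_smult_distrib[of _ N N _ N])
  have FT: "F\<^sup>T \<in> carrier_mat N N" using F by simp
  have z: "c \<cdot>\<^sub>m M + (- c) \<cdot>\<^sub>m M = 0\<^sub>m N N" "(- c) \<cdot>\<^sub>m M + c \<cdot>\<^sub>m M = 0\<^sub>m N N"
    if "M \<in> carrier_mat N N" for M :: "real mat" and c
    using that by (auto intro!: eq_matI)
  have "H * H = four_block_mat
      ((\<alpha> \<cdot>\<^sub>m 1\<^sub>m N) * (\<alpha> \<cdot>\<^sub>m 1\<^sub>m N) + F\<^sup>T * F)
      ((\<alpha> \<cdot>\<^sub>m 1\<^sub>m N) * F\<^sup>T + F\<^sup>T * - (\<alpha> \<cdot>\<^sub>m 1\<^sub>m N))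
      (F * (\<alpha> \<cdot>\<^sub>m 1\<^sub>m N) + - (\<alpha> \<cdot>\<^sub>m 1\<^sub>m N) * F)
      (F * F\<^sup>T + - (\<alpha> \<cdot>\<^sub>m 1\<^sub>m N) * - (\<alpha> \<cdot>\<^sub>m 1\<^sub>m N))"
    unfolding H_def using F by (intro mult_four_block_mat[of _ N N _ N _ N]) auto
  also have "\<dots> = four_block_mat (S * S) (0\<^sub>m N N) (0\<^sub>m N N) (R * R)"
    unfolding neg unfolding id l[OF F] l[OF FT] z[OF F] z[OF FT] assms
    using F by (simp add: comm_add_mat[of "\<alpha>\<^sup>2 \<cdot>\<^sub>m 1\<^sub>m N" N N])
  also have "\<dots> = P * P"
    unfolding P_def using S R by (subst mult_four_block_mat[of _ N N _ N _ N]) auto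
  finally show ?thesis .
qed

lemma split_vec:
  fixes x :: "real vec"
  assumes "x \<in> carrier_vec (2 * N)"
  obtains u v where "u \<in> carrier_vec N" "v \<in> carrier_vec N" "x = u @\<^sub>v v"
    "\<And>i. i < N \<Longrightarrow> u $ i = x $ i" "\<And>i. i < N \<Longrightarrow> v $ i = x $ (N + i)"
proof
  show "vec_first x N \<in> carrier_vec N" "vec_last x N \<in> carrier_vec N" by auto
  show "x = vec_first x N @\<^sub>v vec_last x N" using assms by (simp add: mult_2)
  show "vec_first x N $ i = x $ i" "vec_last x N $ i = x $ (N + i)" if "i < N" for i
    using that assms by (auto simp: vec_first_def vec_last_def)
qed

text \<open>The off-diagonal blocks enter only through the mixed term in \<open>u\<close> and
  \<open>v\<close>. Once one half of the vector vanishes, the form is \<alpha> or -\<alpha> times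
  the squared norm of the other half.\<close>

lemma saddle_form:
  assumes "u \<in> carrier_vec N" "v \<in> carrier_vec N"
  shows "(u @\<^sub>v v) \<bullet> (H *\<^sub>v (u @\<^sub>v v)) = \<alpha> * (u \<bullet> u) + 2 * (v \<bullet> (F *\<^sub>v u)) - \<alpha> * (v \<bullet> v)"
proof -
  have c: "F *\<^sub>v u \<in> carrier_vec N" "F\<^sup>T *\<^sub>v v \<in> carrier_vec N" using F assms by auto
  note s = smult_one_mult_mat_vec[of _ N \<alpha>]
  have "- (\<alpha> \<cdot>\<^sub>m 1\<^sub>m N) *\<^sub>v v = - (\<alpha> \<cdot>\<^sub>v v)"
    using assms s[of v] by (simp add: uminus_mult_mat_vec)
  hence "H *\<^sub>v (u @\<^sub>v v) = (\<alpha> \<cdot>\<^sub>v u + F\<^sup>T *\<^sub>v v) @\<^sub>v (F *\<^sub>v u + - (\<alpha> \<cdot>\<^sub>v v))"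
    unfolding H_def using F assms s by (subst four_block_mat_mult_vec[of _ N N _ N _ N]) auto
  moreover have "u \<bullet> (F\<^sup>T *\<^sub>v v) = v \<bullet> (F *\<^sub>v u)"
    using comm_scalar_prod[OF assms(1) c(2)] transpose_vec_mult_scalar[OF F assms] by simp
  ultimately show ?thesis using assms c
    by (simp add: scalar_prod_append[of _ N _ N] scalar_prod_add_distrib[of _ N])
qed

lemma block_diag_form:
  assumes "u \<in> carrier_vec N" "v \<in> carrier_vec N"
  shows "(u @\<^sub>v v) \<bullet> (P *\<^sub>v (u @\<^sub>v v)) = u \<bullet> (S *\<^sub>v u) + v \<bullet> (R *\<^sub>v v)"
proof -
  have c: "S *\<^sub>v u \<in> carrier_vec N" "R *\<^sub>v v \<in> carrier_vec N" using S R assms by auto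
  have "P *\<^sub>v (u @\<^sub>v v) = (S *\<^sub>v u) @\<^sub>v (R *\<^sub>v v)"
    unfolding P_def using S R assms by (subst four_block_mat_mult_vec[of _ N N _ N _ N]) auto
  thus ?thesis using assms c by (simp add: scalar_prod_append[of _ N _ N])
qed

lemma block_diag_form_gt:
  assumes Sgt: "\<And>x. x \<in> carrier_vec N \<Longrightarrow> x \<noteq> 0\<^sub>v N \<Longrightarrow> \<alpha> * (x \<bullet> x) < x \<bullet> (S *\<^sub>v x)"
    and Rgt: "\<And>x. x \<in> carrier_vec N \<Longrightarrow> x \<noteq> 0\<^sub>v N \<Longrightarrow> \<alpha> * (x \<bullet> x) < x \<bullet> (R *\<^sub>v x)"
    and x: "x \<in> carrier_vec (2 * N)" "x \<noteq> 0\<^sub>v (2 * N)"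
  shows "\<alpha> * (x \<bullet> x) < x \<bullet> (P *\<^sub>v x)"
proof -
  obtain u v where uv: "u \<in> carrier_vec N" "v \<in> carrier_vec N" "x = u @\<^sub>v v"
      and ui: "\<And>i. i < N \<Longrightarrow> u $ i = x $ i" and vi: "\<And>i. i < N \<Longrightarrow> v $ i = x $ (N + i)"
    using that by (rule split_vec[OF x(1)])
  have "0\<^sub>v N @\<^sub>v 0\<^sub>v N = (0\<^sub>v (2 * N) :: real vec)" by (intro eq_vecI) auto
  hence ne: "u \<noteq> 0\<^sub>v N \<or> v \<noteq> 0\<^sub>v N" using x(2) uv(3) by auto
  \<comment> \<open>One half of a nonzero vector may be zero, so each half gets the weak inequality
    and strictness comes from a half that is nonzero.\<close>
  have le: "\<alpha> * (u \<bullet> u) \<le> u \<bullet> (S *\<^sub>v u)" "\<alpha> * (v \<bullet> v) \<le> v \<bullet> (R *\<^sub>v v)"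
  proof -
    show "\<alpha> * (u \<bullet> u) \<le> u \<bullet> (S *\<^sub>v u)"
      by (cases "u = 0\<^sub>v N") (use Sgt[OF uv(1)] S in \<open>auto intro: less_imp_le\<close>)
    show "\<alpha> * (v \<bullet> v) \<le> v \<bullet> (R *\<^sub>v v)"
      by (cases "v = 0\<^sub>v N") (use Rgt[OF uv(2)] R in \<open>auto intro: less_imp_le\<close>)
  qed
  have "\<alpha> * (u \<bullet> u) + \<alpha> * (v \<bullet> v) < u \<bullet> (S *\<^sub>v u) + v \<bullet> (R *\<^sub>v v)"
    using ne Sgt[OF uv(1)] Rgt[OF uv(2)] le by linarith
  thus ?thesis
    unfolding uv(3) block_diag_form[OF uv(1,2)] using uv(1,2)
    by (simp add: scalar_prod_append[of _ N _ N] algebra_simps)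
qed

lemma saddle_positive:
  assumes "\<alpha> > 0" and x: "x \<in> carrier_vec (2 * N)" "x \<noteq> 0\<^sub>v (2 * N)"
    and orth: "\<And>s. s \<in> unit_vec (2 * N) ` {N..<2 * N} \<Longrightarrow> s \<bullet> x = 0"
  shows "0 < x \<bullet> (H *\<^sub>v x)"
proof -
  obtain u v where uv: "u \<in> carrier_vec N" "v \<in> carrier_vec N" "x = u @\<^sub>v v"
      and ui: "\<And>i. i < N \<Longrightarrow> u $ i = x $ i" and vi: "\<And>i. i < N \<Longrightarrow> v $ i = x $ (N + i)"
    using that by (rule split_vec[OF x(1)])
  have v: "v = 0\<^sub>v N"
  proof (rule eq_vecI)
    fix i assume "i < dim_vec (0\<^sub>v N :: real vec)"
    hence i: "i < N" by simp
    hence "unit_vec (2 * N) (N + i) \<bullet> x = 0" by (intro orth) auto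
    thus "v $ i = 0\<^sub>v N $ i" using i x(1) vi by simp
  qed (use uv in auto)
  have "0\<^sub>v N @\<^sub>v 0\<^sub>v N = (0\<^sub>v (2 * N) :: real vec)" by (intro eq_vecI) auto
  hence "u \<noteq> 0\<^sub>v N" using x(2) uv(3) v by auto
  hence "u \<bullet> u > 0" by (rule scalar_prod_self_pos[OF uv(1)])
  moreover have "F *\<^sub>v u \<in> carrier_vec N" using F uv by simp
  ultimately show ?thesis
    unfolding uv(3) saddle_form[OF uv(1,2)] using assms(1) by (simp add: v)
qed

lemma saddle_negative:
  assumes "\<alpha> > 0" and x: "x \<in> carrier_vec (2 * N)" "x \<noteq> 0\<^sub>v (2 * N)"
    and orth: "\<And>s. s \<in> unit_vec (2 * N) ` {..<N} \<Longrightarrow> s \<bullet> x = 0"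
  shows "x \<bullet> (H *\<^sub>v x) < 0"
proof -
  obtain u v where uv: "u \<in> carrier_vec N" "v \<in> carrier_vec N" "x = u @\<^sub>v v"
      and ui: "\<And>i. i < N \<Longrightarrow> u $ i = x $ i" and vi: "\<And>i. i < N \<Longrightarrow> v $ i = x $ (N + i)"
    using that by (rule split_vec[OF x(1)])
  have u: "u = 0\<^sub>v N"
  proof (rule eq_vecI)
    fix i assume "i < dim_vec (0\<^sub>v N :: real vec)"
    hence i: "i < N" by simp
    hence "unit_vec (2 * N) i \<bullet> x = 0" by (intro orth) auto
    thus "u $ i = 0\<^sub>v N $ i" using i x(1) ui by simp
  qed (use uv in auto)
  have "0\<^sub>v N @\<^sub>v 0\<^sub>v N = (0\<^sub>v (2 * N) :: real vec)" by (intro eq_vecI) auto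
  hence "v \<noteq> 0\<^sub>v N" using x(2) uv(3) u by auto
  hence "v \<bullet> v > 0" by (rule scalar_prod_self_pos[OF uv(2)])
  moreover have "F *\<^sub>v 0\<^sub>v N = 0\<^sub>v N" using F by (intro eq_vecI) auto
  ultimately show ?thesis
    unfolding uv(3) saddle_form[OF uv(1,2)] using assms(1) uv(2) by (simp add: u)
qed

end

section \<open>Eigenvalue counts\<close>

lemma size_filter_image_lessThan:
  "size {# z \<in># image_mset f (mset_set {..<k}). Q z #} = card {i. i < k \<and> Q (f i)}" for k :: nat
proof -
  have "{# z \<in># image_mset f (mset_set {..<k}). Q z #} = image_mset f {# i \<in># mset_set {..<k}. Q (f i) #}"
    by (simp add: filter_mset_image_mset)
  moreover have "{i \<in> {..<k}. Q (f i)} = {i. i < k \<and> Q (f i)}" by auto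
  ultimately show ?thesis by simp
qed

text \<open>Multiplicities in the complex multiset become cardinalities of sets of indices, since
  the embedding of the reals is injective.\<close>

lemma eigvals_counts:
  assumes l: "eigvals_mset M = image_mset (\<lambda>i. complex_of_real (l i)) (mset_set {..<k :: nat})"
  shows "count (eigvals_mset M) (complex_of_real r) = card {i. i < k \<and> l i = r}"
    and "num_eigvals_in M X = card {i. i < k \<and> l i \<in> X}"
    and "size {# z \<in># eigvals_mset M. z \<noteq> 1 \<and> z \<noteq> - 1 #} = card {i. i < k \<and> l i \<noteq> 1 \<and> l i \<noteq> - 1}"
proof -
  have "count (eigvals_mset M) (complex_of_real r) = size {# z \<in># eigvals_mset M. z = complex_of_real r #}"
    by (simp add: filter_eq_replicate_mset)
  thus "count (eigvals_mset M) (complex_of_real r) = card {i. i < k \<and> l i = r}"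
    unfolding l size_filter_image_lessThan by simp
  have "complex_of_real x \<in> complex_of_real ` X \<longleftrightarrow> x \<in> X" for x by auto
  thus "num_eigvals_in M X = card {i. i < k \<and> l i \<in> X}"
    unfolding num_eigvals_in_def l size_filter_image_lessThan by simp
  have "complex_of_real x = - 1 \<longleftrightarrow> x = - 1" for x
    by (metis of_real_1 of_real_eq_iff of_real_minus)
  thus "size {# z \<in># eigvals_mset M. z \<noteq> 1 \<and> z \<noteq> - 1 #} = card {i. i < k \<and> l i \<noteq> 1 \<and> l i \<noteq> - 1}"
    unfolding l size_filter_image_lessThan by simp
qed

lemma spectrum_eq_set_eigvals_mset:
  assumes "A \<in> carrier_mat n n"
  shows "spectrum (complex_mat A) = set_mset (eigvals_mset A)"
proof -
  have A: "complex_mat A \<in> carrier_mat n n" using assms by simp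
  have "char_poly (complex_mat A) \<noteq> 0" using degree_monic_char_poly[OF A] by auto
  thus ?thesis unfolding eigvals_mset_def spectrum_root_char_poly[OF A] by simp
qed

theorem theorem3p7:
  fixes m n :: nat
    and \<Delta> \<T> \<A> absH M :: "real mat"
    and T \<gamma> \<tau> \<alpha> :: real
  assumes m: "m \<ge> 1" and n: "n \<ge> 1"
    and \<Delta>: "\<Delta> \<in> carrier_mat m m" "sym_pos_def (- \<Delta>)"
    and T: "T > 0" and \<gamma>: "\<gamma> > 0"
    and \<tau>: "\<tau> = T / real n"
    and \<alpha>: "\<alpha> = \<tau>\<^sup>2 / sqrt \<gamma>"
    and \<T>: "\<T> = B1 n \<otimes>\<^sub>k 1\<^sub>m m - (\<tau>\<^sup>2 / 2) \<cdot>\<^sub>m (B2 n \<otimes>\<^sub>k \<Delta>)"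
    and \<A>: "\<A> = four_block_mat
               (\<alpha> \<cdot>\<^sub>m (I_check n \<otimes>\<^sub>k 1\<^sub>m m)) (\<T>\<^sup>T)
               \<T> (- (\<alpha> \<cdot>\<^sub>m (I_hat n \<otimes>\<^sub>k 1\<^sub>m m)))"
    and absH: "absH = four_block_mat
               (mat_sqrt (\<T>\<^sup>T * \<T> + \<alpha>\<^sup>2 \<cdot>\<^sub>m 1\<^sub>m (m * n))) (0\<^sub>m (m * n) (m * n))
               (0\<^sub>m (m * n) (m * n)) (mat_sqrt (\<T> * \<T>\<^sup>T + \<alpha>\<^sup>2 \<cdot>\<^sub>m 1\<^sub>m (m * n)))"
    and M: "M = mat_inv absH * \<A>"
  shows
    "(int n * int m - 2 * int m \<le> int (count (eigvals_mset M) 1) \<and>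
      int n * int m - 2 * int m \<le> int (count (eigvals_mset M) (- 1))) \<and>
     size {# z \<in># eigvals_mset M. z \<noteq> 1 \<and> z \<noteq> - 1 #} \<le> 4 * m \<and>
     (spectrum (complex_mat M) \<subseteq> complex_of_real ` ({- 3 / 2 <..< - 1 / 2} \<union> {1 / 2 <..< 3 / 2}) \<and>
      num_eigvals_in M {- 3 / 2 <..< - 1} \<le> m \<and>
      num_eigvals_in M {- 1 <..< - 1 / 2} \<le> m \<and>
      num_eigvals_in M {1 / 2 <..< 1} \<le> m \<and>
      num_eigvals_in M {1 <..< 3 / 2} \<le> m)"
proof -
  define N where "N = n * m"
  have \<alpha>0: "\<alpha> > 0" using T \<gamma> n by (simp add: \<alpha> \<tau>)
  have F: "\<T> \<in> carrier_mat N N" unfolding \<T> N_def by (rule block_toeplitz_carrier[OF \<Delta>(1)])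
  have inj: "x = 0\<^sub>v N" if "x \<in> carrier_vec N" "\<T> *\<^sub>v x = 0\<^sub>v N" for x
    using block_toeplitz_injective[OF \<Delta>, of "\<tau>\<^sup>2 / 2" x n] that unfolding \<T> N_def by simp
  have FT: "\<T>\<^sup>T \<in> carrier_mat N N" using F by simp
  have injT: "x = 0\<^sub>v N" if "x \<in> carrier_vec N" "\<T>\<^sup>T *\<^sub>v x = 0\<^sub>v N" for x
    by (rule transpose_injective[OF F inj that])
  define S where "S = mat_sqrt (\<T>\<^sup>T * \<T> + \<alpha>\<^sup>2 \<cdot>\<^sub>m 1\<^sub>m N)"
  define R where "R = mat_sqrt (\<T> * \<T>\<^sup>T + \<alpha>\<^sup>2 \<cdot>\<^sub>m 1\<^sub>m N)"
  note S = gram_sqrt[OF F inj, where \<alpha> = \<alpha>, folded S_def]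
  note R = gram_sqrt[OF FT injT, where \<alpha> = \<alpha>, unfolded transpose_transpose, folded R_def]
  define H where "H = four_block_mat (\<alpha> \<cdot>\<^sub>m 1\<^sub>m N) (\<T>\<^sup>T) \<T> (- (\<alpha> \<cdot>\<^sub>m 1\<^sub>m N))"
  have absH': "absH = four_block_mat S (0\<^sub>m N N) (0\<^sub>m N N) R"
    unfolding absH S_def R_def N_def by (simp only: mult.commute[of m n])
  \<comment> \<open>Halving turns \<alpha> into \<alpha>/2 in the last block of the upper half, a
    change by -\<alpha>/2, and -\<alpha> into -\<alpha>/2 in the first block of the lower half, a
    change by \<alpha>/2. For n = 1 each of these blocks is a whole half.\<close>
  define e where "e = (\<lambda>i. if i < N then if N - m \<le> i then - \<alpha> / 2 else 0
    else if i < N + m then \<alpha> / 2 else 0)"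
  have A_eq: "\<A> = H + mat_diag (2 * N) e"
  proof -
    have check: "\<alpha> \<cdot>\<^sub>m (I_check n \<otimes>\<^sub>k 1\<^sub>m m) = mat_diag N (\<lambda>i. \<alpha> + e i)"
      unfolding I_check_def kron_mat_diag_one N_def[symmetric]
    proof (rule eq_matI)
      fix i j assume "i < dim_row (mat_diag N (\<lambda>i. \<alpha> + e i))" "j < dim_col (mat_diag N (\<lambda>i. \<alpha> + e i))"
      hence ij: "i < N" "j < N" by (auto simp: mat_diag_def)
      have "j div m < n" using ij by (simp add: N_def less_mult_imp_div_less)
      \<comment> \<open>Block numbers are at most n - 1, so lying in the last block is an
        inequality, which translates into a bound on the index itself.\<close>
      hence "j div m = n - 1 \<longleftrightarrow> n - 1 \<le> j div m" by linarith
      also have "\<dots> \<longleftrightarrow> N - m \<le> j"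
        using m by (simp add: less_eq_div_iff_mult_less_eq N_def diff_mult_distrib)
      finally show "(\<alpha> \<cdot>\<^sub>m mat_diag N (\<lambda>i. if i div m = n - 1 then 1 / 2 else 1)) $$ (i, j)
          = mat_diag N (\<lambda>i. \<alpha> + e i) $$ (i, j)"
        using ij by (simp add: mat_diag_def e_def)
    qed (auto simp: mat_diag_def)
    have hat: "- (\<alpha> \<cdot>\<^sub>m (I_hat n \<otimes>\<^sub>k 1\<^sub>m m)) = mat_diag N (\<lambda>i. - \<alpha> + e (N + i))"
      unfolding I_hat_def kron_mat_diag_one N_def[symmetric]
    proof (rule eq_matI)
      fix i j assume "i < dim_row (mat_diag N (\<lambda>i. - \<alpha> + e (N + i)))"
        "j < dim_col (mat_diag N (\<lambda>i. - \<alpha> + e (N + i)))"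
      hence ij: "i < N" "j < N" by (auto simp: mat_diag_def)
      have "j div m = 0 \<longleftrightarrow> j < m" using m by (simp add: div_eq_0_iff)
      thus "(- (\<alpha> \<cdot>\<^sub>m mat_diag N (\<lambda>i. if i div m = 0 then 1 / 2 else 1))) $$ (i, j)
          = mat_diag N (\<lambda>i. - \<alpha> + e (N + i)) $$ (i, j)"
        using ij by (simp add: mat_diag_def e_def)
    qed (auto simp: mat_diag_def)
    show ?thesis
      unfolding \<A> check hat H_def using F
      by (intro eq_matI) (auto simp: mat_diag_def)
  qed
  have P: "absH \<in> carrier_mat (2 * N) (2 * N)"
    unfolding absH' by (rule saddle_dims(2)[OF F S(1) R(1)])
  have PT: "absH\<^sup>T = absH"
    unfolding absH' by (rule block_diag_symmetric[OF F S(1) R(1) S(2) R(2)])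
  have H: "H \<in> carrier_mat (2 * N) (2 * N)"
    unfolding H_def by (rule saddle_dims(1)[OF F S(1) R(1)])
  have HT: "H\<^sup>T = H"
    unfolding H_def by (rule saddle_symmetric[OF F S(1) R(1)])
  have HP: "H * H = absH * absH"
    unfolding H_def absH' by (rule saddle_square[OF F S(1) R(1) S(3) R(3)])
  have Pgt: "\<alpha> * (x \<bullet> x) < x \<bullet> (absH *\<^sub>v x)"
    if "x \<in> carrier_vec (2 * N)" "x \<noteq> 0\<^sub>v (2 * N)" for x
    unfolding absH' by (rule block_diag_form_gt[OF F S(1) R(1) S(4) R(4) that])
  have e: "\<forall>i<2 * N. \<bar>e i\<bar> \<le> \<alpha> / 2" using \<alpha>0 by (auto simp: e_def)
  have "{i. i < 2 * N \<and> 0 < e i} \<subseteq> {N..<N + m}" "{i. i < 2 * N \<and> e i < 0} \<subseteq> {N - m..<N}"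
    using \<alpha>0 by (auto simp: e_def split: if_splits)
  from this[THEN card_mono[rotated]]
  have ecard: "card {i. i < 2 * N \<and> 0 < e i} \<le> m" "card {i. i < 2 * N \<and> e i < 0} \<le> m" by auto
  let ?S = "unit_vec (2 * N) ` {N..<2 * N} :: real vec set"
  let ?S' = "unit_vec (2 * N) ` {..<N} :: real vec set"
  have cS: "card ?S \<le> N" "card ?S' \<le> N"
    using card_image_le[of "{N..<2 * N}" "unit_vec (2 * N) :: nat \<Rightarrow> real vec"]
      card_image_le[of "{..<N}" "unit_vec (2 * N) :: nat \<Rightarrow> real vec"] by auto
  have HS: "\<forall>x\<in>carrier_vec (2 * N). x \<noteq> 0\<^sub>v (2 * N) \<longrightarrow> (\<forall>s\<in>?S. s \<bullet> x = 0) \<longrightarrow> 0 < x \<bullet> (H *\<^sub>v x)"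
    unfolding H_def using saddle_positive[OF F S(1) R(1) \<alpha>0] by blast
  have HS': "\<forall>x\<in>carrier_vec (2 * N). x \<noteq> 0\<^sub>v (2 * N) \<longrightarrow> (\<forall>s\<in>?S'. s \<bullet> x = 0) \<longrightarrow> x \<bullet> (H *\<^sub>v x) < 0"
    unfolding H_def using saddle_negative[OF F S(1) R(1) \<alpha>0] by blast
  have Pgt': "\<forall>x\<in>carrier_vec (2 * N). x \<noteq> 0\<^sub>v (2 * N) \<longrightarrow> \<alpha> * (x \<bullet> x) < x \<bullet> (absH *\<^sub>v x)"
    using Pgt by blast
  have fS: "finite ?S" "?S \<subseteq> carrier_vec (2 * N)" "finite ?S'" "?S' \<subseteq> carrier_vec (2 * N)" by auto
  obtain V l where pd: "pair_diag (2 * N) absH (H + mat_diag (2 * N) e) V l"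
    and range: "\<And>i. i < 2 * N \<Longrightarrow> 1 / 2 < l i \<and> l i < 3 / 2 \<or> - 3 / 2 < l i \<and> l i < - 1 / 2"
    and gt1: "card {i. i < 2 * N \<and> 1 < l i} \<le> m" and lt1: "card {i. i < 2 * N \<and> l i < - 1} \<le> m"
    and pos: "card {i. i < 2 * N \<and> 0 < l i \<and> l i < 1} \<le> m"
    and neg: "card {i. i < 2 * N \<and> - 1 < l i \<and> l i < 0} \<le> m"
    and cpos: "card {i. i < 2 * N \<and> 0 < l i} = N" and cneg: "card {i. i < 2 * N \<and> l i < 0} = N"
    using perturbed_pencil_spectrum[OF P PT H HT HP \<alpha>0 Pgt' e ecard fS(1,2) cS(1) HS fS(3,4) cS(2) HS']
    by blast
  have injP: "x = 0\<^sub>v (2 * N)" if x: "x \<in> carrier_vec (2 * N)" "absH *\<^sub>v x = 0\<^sub>v (2 * N)" for x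
  proof (rule ccontr)
    assume "x \<noteq> 0\<^sub>v (2 * N)"
    from Pgt[OF x(1) this] mult_pos_pos[OF \<alpha>0 scalar_prod_self_pos[OF x(1) this]] x
    show False by simp
  qed
  note inv = mat_inv_left[OF P injP]
  have eig: "eigvals_mset M = image_mset (\<lambda>i. complex_of_real (l i)) (mset_set {..<2 * N})"
    unfolding M A_eq by (rule eigvals_mset_pair_diag[OF pd inv])
  note counts = eigvals_counts[OF eig]
  have Mc: "M \<in> carrier_mat (2 * N) (2 * N)" unfolding M A_eq using inv H by simp
  have mono: "card {i. i < 2 * N \<and> Q i} \<le> card {i. i < 2 * N \<and> Q' i}" if "\<And>i. Q i \<Longrightarrow> Q' i" for Q Q'
    by (rule card_mono) (use that in auto)
  have un: "card (A \<union> B \<union> C) \<le> card A + card B + card C" for A B C :: "nat set"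
    using card_Un_le[of A B] card_Un_le[of "A \<union> B" C] by linarith
  \<comment> \<open>Of the \<open>N\<close> positive eigenvalues at most \<open>m\<close> lie below
    1 and at most \<open>m\<close> above, so all but \<open>2 * m\<close> equal 1. The negative ones
    are treated in the same way.\<close>
  have "{i. i < 2 * N \<and> 0 < l i} = {i. i < 2 * N \<and> l i = 1} \<union>
      {i. i < 2 * N \<and> 0 < l i \<and> l i < 1} \<union> {i. i < 2 * N \<and> 1 < l i}" by auto
  hence "card {i. i < 2 * N \<and> 0 < l i} \<le> card {i. i < 2 * N \<and> l i = 1} + card {i. i < 2 * N \<and> 0 < l i \<and> l i < 1}
      + card {i. i < 2 * N \<and> 1 < l i}" by (rule ssubst) (rule un)
  hence one: "N \<le> card {i. i < 2 * N \<and> l i = 1} + 2 * m" using pos gt1 cpos by linarith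
  have "{i. i < 2 * N \<and> l i < 0} = {i. i < 2 * N \<and> l i = - 1} \<union>
      {i. i < 2 * N \<and> - 1 < l i \<and> l i < 0} \<union> {i. i < 2 * N \<and> l i < - 1}" by auto
  hence "card {i. i < 2 * N \<and> l i < 0} \<le> card {i. i < 2 * N \<and> l i = - 1} + card {i. i < 2 * N \<and> - 1 < l i \<and> l i < 0}
      + card {i. i < 2 * N \<and> l i < - 1}" by (rule ssubst) (rule un)
  hence mone: "N \<le> card {i. i < 2 * N \<and> l i = - 1} + 2 * m" using neg lt1 cneg by linarith
  have cnt: "count (eigvals_mset M) 1 = card {i. i < 2 * N \<and> l i = 1}"
    "count (eigvals_mset M) (- 1) = card {i. i < 2 * N \<and> l i = - 1}"
    using counts(1)[of 1] counts(1)[of "- 1"] by simp_all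
  have intN: "int n * int m = int N" by (simp add: N_def)
  have a: "int n * int m - 2 * int m \<le> int (count (eigvals_mset M) 1)"
    "int n * int m - 2 * int m \<le> int (count (eigvals_mset M) (- 1))"
    unfolding intN cnt using one mone by linarith+
  have "{i. i < 2 * N \<and> l i \<noteq> 1 \<and> l i \<noteq> - 1} \<union> ({i. i < 2 * N \<and> l i = 1} \<union> {i. i < 2 * N \<and> l i = - 1}) = {..<2 * N}"
    by auto
  moreover have "card ({i. i < 2 * N \<and> l i \<noteq> 1 \<and> l i \<noteq> - 1} \<union> ({i. i < 2 * N \<and> l i = 1} \<union> {i. i < 2 * N \<and> l i = - 1}))
      = card {i. i < 2 * N \<and> l i \<noteq> 1 \<and> l i \<noteq> - 1} + card ({i. i < 2 * N \<and> l i = 1} \<union> {i. i < 2 * N \<and> l i = - 1})"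
    by (rule card_Un_disjoint) auto
  moreover have "card ({i. i < 2 * N \<and> l i = 1} \<union> {i. i < 2 * N \<and> l i = - 1})
      = card {i. i < 2 * N \<and> l i = 1} + card {i. i < 2 * N \<and> l i = - 1}"
    by (rule card_Un_disjoint) auto
  ultimately have b: "card {i. i < 2 * N \<and> l i \<noteq> 1 \<and> l i \<noteq> - 1} \<le> 4 * m"
    using one mone by simp
  have c0: "spectrum (complex_mat M) \<subseteq> complex_of_real ` ({- 3 / 2 <..< - 1 / 2} \<union> {1 / 2 <..< 3 / 2})"
    unfolding spectrum_eq_set_eigvals_mset[OF Mc] eig using range by (fastforce intro!: imageI)
  have c: "card {i. i < 2 * N \<and> l i \<in> {- 3 / 2 <..< - 1}} \<le> m"
    "card {i. i < 2 * N \<and> l i \<in> {- 1 <..< - 1 / 2}} \<le> m"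
    "card {i. i < 2 * N \<and> l i \<in> {1 / 2 <..< 1}} \<le> m"
    "card {i. i < 2 * N \<and> l i \<in> {1 <..< 3 / 2}} \<le> m"
    \<comment> \<open>Each open interval lies in one of the four sets already bounded: below -1,
      between -1 and 0, between 0 and 1, or above 1.\<close>
    by (rule order_trans[OF mono lt1] order_trans[OF mono neg] order_trans[OF mono pos]
        order_trans[OF mono gt1]; force)+
  show ?thesis
    unfolding counts(2,3) using a b c0 c by blast
qed

end
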